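(* Let $n\ge 1$. For a constant $R>1$, let $\Omega_1$ and $\Omega_0$ be the open balls in $\mathbb{R}^n$ centered at the origin, of radii $R$ and $R+1$ respectively, and let $\Omega=\Omega_0\setminus\overline{\Omega}_1$, so that $\overline{\Omega}=\{x\in\mathbb{R}^n : R\le |x|\le R+1\}$. For $R$ sufficiently large, there is an admissible function $u_0$ on $\overline{\Omega}$ such that, denoting by $u(x,t)$ the solution of $$\left\{\begin{array}{ll} \partial u/\partial t=\Delta u, & \text{on } \Omega\times(0,\infty)\\ u(x,0)=u_0(x), & x\in\Omega\\ u(x,t)=0, & (x,t)\in\partial\Omega_0\times[0,\infty)\\ u(x,t)=1, & (x,t)\in\partial\Omega_1\times[0,\infty),\end{array}\right.$$ the following properties hold: (i) $u_0$ is radially symmetric, and hence $x\mapsto u(x,t)$ is quasiconcave on $\overline{\Omega}$ for every $t\ge 0$. (ii) $u(x,t)$ is smooth on $\overline{\Omega}\times[0,\infty)$. (iii) $u(x,t)$ is not space-time quasiconcave on $\overline{\Omega}\times[0,T)$ for any $T>0$.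
   Context: Here $\Delta$ and $\nabla$ are the Laplacian and the gradient in the space variable $x\in\mathbb{R}^n$, and solutions are understood in the classical sense. Quasiconcave: a function $w$ on $\overline{\Omega}$ is quasiconcave if for every $c\in\mathbb{R}$ the set $\{x\in\overline{\Omega} \mid w(x)\ge c\}\cup\Omega_1$ is a convex subset of $\mathbb{R}^n$. Space-time quasiconcave: for $0<T\le\infty$, a function $u=u(x,t)$ on $\overline{\Omega}\times[0,T)$ is space-time quasiconcave if for every $c\in\mathbb{R}$ the set $\{(x,t)\in\overline{\Omega}\times[0,T) \mid u(x,t)\ge c\}\cup(\Omega_1\times[0,T))$ is a convex subset of $\mathbb{R}^{n+1}$. Admissible: a function $u_0$ on $\overline{\Omega}$ is admissible if it is smooth on $\overline{\Omega}$ and satisfies: $u_0=1$ on $\partial\Omega_1$; $u_0=0$ on $\partial\Omega_0$; $x\cdot\nabla u_0(x)\le 0$ on $\Omega$; and $\Delta u_0\ge 0$ on $\Omega$ with $\Delta u_0$ not identically zero. *)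

theory Defs
  imports "HOL-Analysis.Analysis"
begin

subsection \<open>Differential operators and smoothness\<close>

definition dir_deriv :: "'a::real_normed_vector \<Rightarrow> ('a \<Rightarrow> real) \<Rightarrow> 'a \<Rightarrow> real" where
  "dir_deriv v f x = frechet_derivative f (at x) v"

abbreviation partial :: "'n::finite \<Rightarrow> (real ^ 'n \<Rightarrow> real) \<Rightarrow> real ^ 'n \<Rightarrow> real" where
  "partial i \<equiv> dir_deriv (axis i 1)"

definition gradient :: "(real ^ 'n::finite \<Rightarrow> real) \<Rightarrow> real ^ 'n \<Rightarrow> real ^ 'n" where
  "gradient f x = (\<chi> i. partial i f x)"

definition laplacian :: "(real ^ 'n::finite \<Rightarrow> real) \<Rightarrow> real ^ 'n \<Rightarrow> real" where
  "laplacian f x = (\<Sum>i\<in>UNIV. partial i (partial i f) x)"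

text \<open>Class \<open>C\<^sup>k\<close> on a set \<open>U\<close>; to be used for open \<open>U\<close> only, since the derivatives are two-sided.\<close>

primrec Ck_on :: "nat \<Rightarrow> 'a::euclidean_space set \<Rightarrow> ('a \<Rightarrow> real) \<Rightarrow> bool" where
  "Ck_on 0 U f \<longleftrightarrow> continuous_on U f"
| "Ck_on (Suc k) U f \<longleftrightarrow>
     (\<forall>x\<in>U. f differentiable (at x)) \<and> (\<forall>v. Ck_on k U (dir_deriv v f))"

text \<open>Smoothness on a set that need not be open (below: closed up to the boundary) means, as usual,
  being the restriction of a \<open>C\<^sup>\<infinity>\<close> function defined on an open neighbourhood of the set.\<close>

definition smooth_on :: "'a::euclidean_space set \<Rightarrow> ('a \<Rightarrow> real) \<Rightarrow> bool" where
  "smooth_on A f \<longleftrightarrow>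
     (\<exists>U g. open U \<and> A \<subseteq> U \<and> (\<forall>k. Ck_on k U g) \<and> (\<forall>x\<in>A. g x = f x))"


subsection \<open>Domains and quasiconcavity\<close>

text \<open>Throughout, \<open>\<Omega> = ring_domain \<Omega>0 \<Omega>1\<close>.\<close>

definition ring_domain :: "(real ^ 'n::finite) set \<Rightarrow> (real ^ 'n) set \<Rightarrow> (real ^ 'n) set" where
  "ring_domain \<Omega>0 \<Omega>1 = \<Omega>0 - closure \<Omega>1"

definition quasiconcave ::
  "(real ^ 'n::finite) set \<Rightarrow> (real ^ 'n) set \<Rightarrow> (real ^ 'n \<Rightarrow> real) \<Rightarrow> bool" where
  "quasiconcave \<Omega>0 \<Omega>1 w \<longleftrightarrow>
     (\<forall>c. convex ({x \<in> closure (ring_domain \<Omega>0 \<Omega>1). w x \<ge> c} \<union> \<Omega>1))"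

text \<open>The time interval \<open>[0,T)\<close>, where \<open>T = \<infinity>\<close> is allowed.\<close>

definition time_interval :: "ereal \<Rightarrow> real set" where
  "time_interval T = {t. 0 \<le> t \<and> ereal t < T}"

definition spacetime_quasiconcave ::
  "(real ^ 'n::finite) set \<Rightarrow> (real ^ 'n) set \<Rightarrow> ereal \<Rightarrow> ((real ^ 'n) \<times> real \<Rightarrow> real) \<Rightarrow> bool" where
  "spacetime_quasiconcave \<Omega>0 \<Omega>1 T u \<longleftrightarrow>
     (\<forall>c. convex ({p \<in> closure (ring_domain \<Omega>0 \<Omega>1) \<times> time_interval T. u p \<ge> c}
                   \<union> \<Omega>1 \<times> time_interval T))"


subsection \<open>Admissible initial data and the initial-boundary value problem\<close>

definition admissible ::
  "(real ^ 'n::finite) set \<Rightarrow> (real ^ 'n) set \<Rightarrow> (real ^ 'n \<Rightarrow> real) \<Rightarrow> bool" where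
  "admissible \<Omega>0 \<Omega>1 u0 \<longleftrightarrow>
     smooth_on (closure (ring_domain \<Omega>0 \<Omega>1)) u0 \<and>
     (\<forall>x\<in>frontier \<Omega>1. u0 x = 1) \<and>
     (\<forall>x\<in>frontier \<Omega>0. u0 x = 0) \<and>
     (\<forall>x\<in>ring_domain \<Omega>0 \<Omega>1. x \<bullet> gradient u0 x \<le> 0) \<and>
     (\<forall>x\<in>ring_domain \<Omega>0 \<Omega>1. laplacian u0 x \<ge> 0) \<and>
     (\<exists>x\<in>ring_domain \<Omega>0 \<Omega>1. laplacian u0 x \<noteq> 0)"

text \<open>The parabolic regularity class \<open>C\<^sup>2\<^sup>,\<^sup>1(\<Omega> \<times> (0,\<infinity>))\<close>: two space derivatives and
  one time derivative exist and are jointly continuous in \<open>(x,t)\<close>.\<close>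

definition C21_on :: "(real ^ 'n::finite) set \<Rightarrow> ((real ^ 'n) \<times> real \<Rightarrow> real) \<Rightarrow> bool" where
  "C21_on \<Omega> u \<longleftrightarrow>
     (\<forall>t>0. Ck_on 2 \<Omega> (\<lambda>x. u (x, t))) \<and>
     (\<forall>x\<in>\<Omega>. \<forall>t>0. (\<lambda>s. u (x, s)) differentiable (at t)) \<and>
     continuous_on (\<Omega> \<times> {0<..}) u \<and>
     continuous_on (\<Omega> \<times> {0<..}) (\<lambda>(x, t). deriv (\<lambda>s. u (x, s)) t) \<and>
     (\<forall>i. continuous_on (\<Omega> \<times> {0<..}) (\<lambda>(x, t). partial i (\<lambda>y. u (y, t)) x)) \<and>
     (\<forall>i j. continuous_on (\<Omega> \<times> {0<..}) (\<lambda>(x, t). partial i (partial j (\<lambda>y. u (y, t))) x))"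

definition heat_solution ::
  "(real ^ 'n::finite) set \<Rightarrow> (real ^ 'n) set \<Rightarrow> (real ^ 'n \<Rightarrow> real) \<Rightarrow>
   ((real ^ 'n) \<times> real \<Rightarrow> real) \<Rightarrow> bool" where
  "heat_solution \<Omega>0 \<Omega>1 u0 u \<longleftrightarrow>
     continuous_on (closure (ring_domain \<Omega>0 \<Omega>1) \<times> {0..}) u \<and>
     C21_on (ring_domain \<Omega>0 \<Omega>1) u \<and>
     (\<forall>x\<in>ring_domain \<Omega>0 \<Omega>1. \<forall>t>0. deriv (\<lambda>s. u (x, s)) t = laplacian (\<lambda>y. u (y, t)) x) \<and>
     (\<forall>x\<in>ring_domain \<Omega>0 \<Omega>1. u (x, 0) = u0 x) \<and>
     (\<forall>x\<in>frontier \<Omega>0. \<forall>t\<ge>0. u (x, t) = 0) \<and>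
     (\<forall>x\<in>frontier \<Omega>1. \<forall>t\<ge>0. u (x, t) = 1)"

definition radially_symmetric_on :: "(real ^ 'n::finite) set \<Rightarrow> (real ^ 'n \<Rightarrow> real) \<Rightarrow> bool" where
  "radially_symmetric_on A w \<longleftrightarrow> (\<forall>x\<in>A. \<forall>y\<in>A. norm x = norm y \<longrightarrow> w x = w y)"

end

theory Submission
  imports Defs
begin

text \<open>
  With a radial harmonic profile \<open>h\<close> (\<open>h = 1\<close> at \<open>R\<close>, \<open>h = 0\<close> at \<open>R + 1\<close>) and radial Dirichlet
  eigenfunctions \<open>f1\<close>, \<open>f2\<close> of the ring for the eigenvalues \<open>l1 < l2\<close>, put
  \<open>u = h - (\<epsilon>/l1) f1 exp (- l1 t) + (\<epsilon>/l2) f2 exp (- l2 t)\<close>. This solves the heat equation and is smooth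
  up to the boundary and the corner, so no parabolic regularity theory is needed. Normalising
  \<open>f1' = f2'\<close> at \<open>R\<close> gives \<open>\<Delta>u0 = \<epsilon> (f1 - f2) \<ge> 0\<close>, by Sturm comparison, and for small \<open>\<epsilon>\<close> the function
  \<open>u\<close> stays radially decreasing.

  Space-time quasiconcavity would force the second derivative
  \<open>Q = u\<^sub>t\<^sup>2 u\<^sub>r\<^sub>r - 2 u\<^sub>t u\<^sub>r u\<^sub>r\<^sub>t + u\<^sub>r\<^sup>2 u\<^sub>t\<^sub>t\<close> along the level curves in the \<open>(r,t)\<close> plane to be nonpositive.
  But at \<open>t = 0\<close> and \<open>r = R + s\<close> one has \<open>u\<^sub>t = o(s)\<close>, because \<open>f1\<close> and \<open>f2\<close> have the same slope at \<open>R\<close>, while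
  \<open>u\<^sub>t\<^sub>t = \<epsilon> (l2 f2 - l1 f1)\<close> is of exact order \<open>(l2 - l1) s > 0\<close>; hence \<open>Q > 0\<close> for small \<open>s\<close> and \<open>t\<close>.
\<close>

subsection \<open>Linear second-order equations\<close>

text \<open>For large \<open>R\<close> the ring looks like a slab of width 1, whose Dirichlet
  eigenfunctions with slope 1 are \<open>sin (pi * s) / pi\<close> and
  \<open>sin (2 * pi * s) / (2 * pi)\<close>. The eigenvalues and the signs of the profiles come
  from this model by a quantitative perturbation estimate and a shooting argument. Uniform closeness
  cannot, however, order the two profiles near \<open>R\<close>: they share value and slope there,
  and their difference is only of third order. This is why a Wronskian argument is used where the
  second profile is positive; elsewhere the order is clear.

  Smoothness up to the boundary asks for a smooth extension, so the profiles are constructed on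
  radii reaching 1/2 beyond the ring on both sides. The harmonic part is treated as a separated
  solution with eigenvalue 0, so that one computation serves all three summands. Since the statement
  speaks of the solution, any other classical solution is compared with the explicit one by the
  maximum principle.\<close>

lemma strict_local_min_second_derivative:
  fixes g g' :: "real \<Rightarrow> real"
  assumes "\<delta> > 0" and g: "\<And>s. \<bar>s\<bar> < \<delta> \<Longrightarrow> (g has_real_derivative g' s) (at s)"
    and g': "(g' has_real_derivative d) (at 0)" and "g' 0 = 0" "d > 0"
  obtains \<eta> where "\<eta> > 0" "\<And>s. 0 < \<bar>s\<bar> \<Longrightarrow> \<bar>s\<bar> < \<eta> \<Longrightarrow> g 0 < g s"
proof -
  obtain a where a: "a > 0" "\<And>h. 0 < h \<Longrightarrow> h < a \<Longrightarrow> g' 0 < g' (0 + h)"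
    using DERIV_pos_inc_right[OF g' \<open>d > 0\<close>] by auto
  obtain b where b: "b > 0" "\<And>h. 0 < h \<Longrightarrow> h < b \<Longrightarrow> g' (0 - h) < g' 0"
    using DERIV_pos_inc_left[OF g' \<open>d > 0\<close>] by auto
  define \<eta> where "\<eta> = min \<delta> (min a b)"
  have "g 0 < g s" if s: "0 < \<bar>s\<bar>" "\<bar>s\<bar> < \<eta>" for s
  proof (cases "s > 0")
    case True
    show ?thesis
    proof (rule DERIV_pos_imp_increasing_open[OF True])
      fix x assume "0 < x" "x < s"
      then show "\<exists>y. DERIV g x :> y \<and> 0 < y"
        using g[of x] a(2)[of x] s assms(4) by (auto simp: \<eta>_def)
    next
      show "continuous_on {0..s} g"
        by (intro DERIV_atLeastAtMost_imp_continuous_on) (use s g in \<open>force simp: \<eta>_def\<close>)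
    qed
  next
    case False
    then have "s < 0" using s by auto
    then show ?thesis
    proof (rule DERIV_neg_imp_decreasing_open)
      fix x assume "s < x" "x < 0"
      then show "\<exists>y. DERIV g x :> y \<and> y < 0"
        using g[of x] b(2)[of "-x"] s assms(4) by (auto simp: \<eta>_def)
    next
      show "continuous_on {s..0} g"
        by (intro DERIV_atLeastAtMost_imp_continuous_on) (use s g in \<open>force simp: \<eta>_def\<close>)
    qed
  qed
  then show ?thesis using that[of \<eta>] a(1) b(1) assms(1) by (auto simp: \<eta>_def)
qed

text \<open>Each integration from \<open>c\<close> gains a factor
  \<open>\<bar>x - c\<bar> / Suc k\<close>; iterated, this produces the factorials that make
  Picard's series converge. On either side of \<open>c\<close>, \<open>F\<close> is compared with
  the antiderivative of the bound.\<close>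

lemma antiderivative_power_bound:
  fixes F f :: "real \<Rightarrow> real"
  assumes F: "\<And>x. x \<in> {a..b} \<Longrightarrow> (F has_real_derivative f x) (at x within {a..b})"
    and c: "c \<in> {a..b}" "F c = 0" and x: "x \<in> {a..b}"
    and bd: "\<And>x. x \<in> {a..b} \<Longrightarrow> \<bar>f x\<bar> \<le> B * \<bar>x - c\<bar> ^ k"
  shows "\<bar>F x\<bar> \<le> B * \<bar>x - c\<bar> ^ Suc k / Suc k"
proof -
  have Fc: "continuous_on {a..b} F"
    using F by (meson DERIV_continuous_on)
  have Fd: "(F has_real_derivative f y) (at y)" if "a < y" "y < b" for y
    using F[of y] that by (simp add: at_within_Icc_at)
  have ineq: "\<sigma> * F x \<le> B * \<bar>x - c\<bar> ^ Suc k / Suc k" if "\<bar>\<sigma>\<bar> = 1" for \<sigma> :: real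
  proof -
    have \<sigma>f: "\<sigma> * f y \<le> B * \<bar>y - c\<bar> ^ k" "- (B * \<bar>y - c\<bar> ^ k) \<le> \<sigma> * f y" if "y \<in> {a..b}" for y
      using bd[OF that] \<open>\<bar>\<sigma>\<bar> = 1\<close> by (auto simp: abs_if split: if_splits)
    show ?thesis
    proof (cases "c \<le> x")
      case True
      let ?G = "\<lambda>y. B * (y - c) ^ Suc k / Suc k - \<sigma> * F y"
      have "?G c \<le> ?G x"
      proof (rule DERIV_nonneg_imp_increasing_open[OF True])
        fix y assume y: "c < y" "y < x"
        then have "(?G has_real_derivative B * (y - c) ^ k - \<sigma> * f y) (at y)"
          using c x by (auto intro!: derivative_eq_intros Fd simp del: power_Suc)
        then show "\<exists>d. DERIV ?G y :> d \<and> 0 \<le> d"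
          using \<sigma>f[of y] y c x by auto
      next
        show "continuous_on {c..x} ?G"
          using c x by (intro continuous_intros continuous_on_subset[OF Fc]) auto
      qed
      then show ?thesis using True c by simp
    next
      case False
      then have le: "x \<le> c" by simp
      let ?G = "\<lambda>y. - B * (c - y) ^ Suc k / Suc k + \<sigma> * F y"
      have "?G x \<le> ?G c"
      proof (rule DERIV_nonneg_imp_increasing_open[OF le])
        fix y assume y: "x < y" "y < c"
        then have "(?G has_real_derivative B * (c - y) ^ k + \<sigma> * f y) (at y)"
          using c x by (auto intro!: derivative_eq_intros Fd simp del: power_Suc)
        then show "\<exists>d. DERIV ?G y :> d \<and> 0 \<le> d"
          using \<sigma>f[of y] y c x by (auto simp: abs_minus_commute)
      next
        show "continuous_on {x..c} ?G"
          using c x by (intro continuous_intros continuous_on_subset[OF Fc]) auto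
      qed
      then show ?thesis using le c by simp
    qed
  qed
  show ?thesis using ineq[of 1] ineq[of "-1"] by linarith
qed

text \<open>Picard iteration for the system \<open>y' = z\<close>, \<open>z' = p * y\<close>, summed
  as a series of increments. Linearity gives convergence on the whole interval, and an interior
  \<open>c\<close> is allowed, so that solutions extend to both sides of the initial point.\<close>

lemma linear_second_order_ivp:
  fixes p :: "real \<Rightarrow> real"
  assumes c: "c \<in> {a..b}" and p: "continuous_on {a..b} p"
  obtains y z where "y c = y0" "z c = z0"
    "\<And>x. x \<in> {a..b} \<Longrightarrow> (y has_real_derivative z x) (at x within {a..b})"
    "\<And>x. x \<in> {a..b} \<Longrightarrow> (z has_real_derivative p x * y x) (at x within {a..b})"
proof -
  let ?S = "{a..b}"
  have "\<exists>F. F c = 0 \<and> (\<forall>x\<in>?S. (F has_real_derivative f x) (at x within ?S))"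
    if f: "continuous_on ?S f" for f :: "real \<Rightarrow> real"
  proof -
    obtain g where g: "\<And>x. x \<in> ?S \<Longrightarrow> (g has_vector_derivative f x) (at x within ?S)"
      using antiderivative_continuous[OF f] by blast
    then show ?thesis
      by (intro exI[of _ "\<lambda>x. g x - g c"])
         (auto intro!: derivative_eq_intros simp: has_real_derivative_iff_has_vector_derivative)
  qed
  then obtain P where P: "\<And>f. continuous_on ?S f \<Longrightarrow> P f c = 0"
    "\<And>f x. continuous_on ?S f \<Longrightarrow> x \<in> ?S \<Longrightarrow> (P f has_real_derivative f x) (at x within ?S)"
    by metis
  \<comment> \<open>Increments, not partial sums: \<open>w 0\<close> is the constant initial pair
    and each further pair integrates the previous one from \<open>c\<close>, so only
    \<open>w 0\<close> contributes at \<open>c\<close>.\<close>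
  define w where "w = rec_nat (\<lambda>_. y0, \<lambda>_. z0) (\<lambda>_ (u, v). (P v, P (\<lambda>x. p x * u x)))"
  define u v where "u = (\<lambda>k. fst (w k))" and "v = (\<lambda>k. snd (w k))"
  have uv0: "u 0 = (\<lambda>_. y0)" "v 0 = (\<lambda>_. z0)"
    by (auto simp: u_def v_def w_def)
  have uvS: "u (Suc k) = P (v k)" "v (Suc k) = P (\<lambda>x. p x * u k x)" for k
    by (auto simp: u_def v_def w_def split_beta)
  have Pc: "continuous_on ?S (P f)" if "continuous_on ?S f" for f
    using P(2)[OF that] by (meson DERIV_continuous_on)
  have cont: "continuous_on ?S (u k) \<and> continuous_on ?S (v k)" for k
    by (induction k) (auto simp: uv0 uvS intro!: Pc continuous_intros p)
  have du: "(u (Suc k) has_real_derivative v k x) (at x within ?S)"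
    and dv: "(v (Suc k) has_real_derivative p x * u k x) (at x within ?S)" if "x \<in> ?S" for k x
    using P(2) cont that p by (auto simp: uvS intro!: P(2) continuous_intros)
  have uc: "u (Suc k) c = 0" "v (Suc k) c = 0" for k
    using cont p by (auto simp: uvS intro!: P(1) continuous_intros)
  obtain K0 where K0: "\<And>x. x \<in> ?S \<Longrightarrow> \<bar>p x\<bar> \<le> K0"
    using compact_imp_bounded[OF compact_continuous_image[OF p]]  unfolding bounded_iff
    by (auto simp del: atLeastAtMost_iff)
  \<comment> \<open>The lower bound 1 lets one constant serve both components: the first integrates
    \<open>v k\<close> with coefficient 1, the second integrates \<open>p x * u k x\<close>.\<close>
  define K where "K = max 1 K0"
  have K: "1 \<le> K" "\<And>x. x \<in> ?S \<Longrightarrow> \<bar>p x\<bar> \<le> K"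
    using K0 by (force simp: K_def)+
  define M where "M = max \<bar>y0\<bar> \<bar>z0\<bar>"
  have M: "0 \<le> M" by (simp add: M_def)
  have bd: "\<forall>x\<in>?S. \<bar>u k x\<bar> \<le> M * K^k / fact k * \<bar>x - c\<bar>^k \<and> \<bar>v k x\<bar> \<le> M * K^k / fact k * \<bar>x - c\<bar>^k" for k
  proof (induction k)
    case 0
    show ?case by (simp add: uv0 M_def)
  next
    case (Suc k)
    have le: "t * (M * K^k / fact k * \<bar>x - c\<bar>^k) \<le> M * K^Suc k / fact k * \<bar>x - c\<bar>^k" if "t \<le> K" for t x
    proof -
      have "t * (M * K^k / fact k * \<bar>x - c\<bar>^k) \<le> K * (M * K^k / fact k * \<bar>x - c\<bar>^k)"
        using that K(1) M by (intro mult_right_mono) auto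
      then show ?thesis by (simp add: mult_ac)
    qed
    have eq: "M * K^Suc k / fact k * \<bar>x - c\<bar>^Suc k / Suc k = M * K^Suc k / fact (Suc k) * \<bar>x - c\<bar>^Suc k" for x
      by (simp add: field_simps)
    show ?case
    proof (intro ballI conjI)
      fix x assume x: "x \<in> ?S"
      have "\<bar>u (Suc k) x\<bar> \<le> M * K^Suc k / fact k * \<bar>x - c\<bar>^Suc k / Suc k"
      proof (rule antiderivative_power_bound[OF du c uc(1) x])
        fix x assume "x \<in> ?S"
        then have "\<bar>v k x\<bar> \<le> 1 * (M * K^k / fact k * \<bar>x - c\<bar>^k)" using Suc by auto
        also note le[OF K(1)]
        finally show "\<bar>v k x\<bar> \<le> M * K^Suc k / fact k * \<bar>x - c\<bar>^k" .
      qed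
      then show "\<bar>u (Suc k) x\<bar> \<le> M * K^Suc k / fact (Suc k) * \<bar>x - c\<bar>^Suc k"
        unfolding eq .
      have "\<bar>v (Suc k) x\<bar> \<le> M * K^Suc k / fact k * \<bar>x - c\<bar>^Suc k / Suc k"
      proof (rule antiderivative_power_bound[OF dv c uc(2) x])
        fix x assume x: "x \<in> ?S"
        then have "\<bar>p x * u k x\<bar> \<le> \<bar>p x\<bar> * (M * K^k / fact k * \<bar>x - c\<bar>^k)"
          using Suc unfolding abs_mult by (intro mult_left_mono) auto
        also note le[OF K(2)[OF x]]
        finally show "\<bar>p x * u k x\<bar> \<le> M * K^Suc k / fact k * \<bar>x - c\<bar>^k" .
      qed
      then show "\<bar>v (Suc k) x\<bar> \<le> M * K^Suc k / fact (Suc k) * \<bar>x - c\<bar>^Suc k"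
        unfolding eq .
    qed
  qed
  define B where "B = (\<lambda>k. M * (inverse (fact k) * (K * (b - a))^k))"
  have B: "summable B"
    unfolding B_def by (intro summable_mult summable_exp)
  have leB: "M * K^k / fact k * \<bar>x - c\<bar>^k \<le> B k" if "x \<in> ?S" for k x
  proof -
    have "M * K^k / fact k * \<bar>x - c\<bar>^k \<le> M * K^k / fact k * (b - a)^k"
      using that c M K(1) by (intro mult_left_mono power_mono) auto
    also have "\<dots> = B k" unfolding B_def power_mult_distrib by (simp add: divide_inverse)
    finally show ?thesis .
  qed
  have uB: "\<bar>u k x\<bar> \<le> B k" and vB: "\<bar>v k x\<bar> \<le> B k" if "x \<in> ?S" for k x
    using bd[of k] leB[OF that, of k] that by force+
  define y z where "y = (\<lambda>x. \<Sum>k. u k x)" and "z = (\<lambda>x. \<Sum>k. v k x)"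
  have su: "summable (\<lambda>k. u k x)" and sv: "summable (\<lambda>k. v k x)" if "x \<in> ?S" for x
    using uB[OF that] vB[OF that] B by (auto intro!: summable_comparison_test[OF _ B])
  \<comment> \<open>Since \<open>u (Suc k)\<close> has derivative \<open>v k\<close>, the
    differentiated tail of the series for \<open>y\<close> is the whole series for \<open>z\<close>;
    the constant term \<open>u 0\<close> is split off and restored in \<open>yg\<close>.\<close>
  have "uniform_limit ?S (\<lambda>n x. \<Sum>k<n. v k x) z sequentially"
    unfolding z_def using vB B by (intro Weierstrass_m_test) auto
  then have "\<exists>g. \<forall>x\<in>?S. (\<lambda>k. u (Suc k) x) sums g x \<and> (g has_real_derivative z x) (at x within ?S)"
    using has_field_derivative_series[of ?S "\<lambda>k. u (Suc k)" v z c] du c uc by (simp del: atLeastAtMost_iff)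
  then obtain g where g: "\<And>x. x \<in> ?S \<Longrightarrow> (\<lambda>k. u (Suc k) x) sums g x"
    "\<And>x. x \<in> ?S \<Longrightarrow> (g has_real_derivative z x) (at x within ?S)"
    by blast
  have yg: "y x = y0 + g x" if "x \<in> ?S" for x
    unfolding y_def using suminf_split_head[OF su[OF that]] sums_unique[OF g(1)[OF that]] by (simp add: uv0)
  have "uniform_limit ?S (\<lambda>n x. \<Sum>k<n. p x * u k x) (\<lambda>x. \<Sum>k. p x * u k x) sequentially"
  proof (rule Weierstrass_m_test)
    fix n x assume x: "x \<in> ?S"
    show "norm (p x * u n x) \<le> K * B n"
      using mult_mono[OF K(2)[OF x] uB[OF x, of n]] K(1) by (simp add: abs_mult)
  qed (intro summable_mult B)
  then have "\<exists>h. \<forall>x\<in>?S. (\<lambda>k. v (Suc k) x) sums h x \<and>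
      (h has_real_derivative (\<Sum>k. p x * u k x)) (at x within ?S)"
    using has_field_derivative_series[of ?S "\<lambda>k. v (Suc k)" "\<lambda>k x. p x * u k x" "\<lambda>x. \<Sum>k. p x * u k x" c] dv c uc
    by (simp del: atLeastAtMost_iff)
  then obtain h where h: "\<And>x. x \<in> ?S \<Longrightarrow> (\<lambda>k. v (Suc k) x) sums h x"
    "\<And>x. x \<in> ?S \<Longrightarrow> (h has_real_derivative (\<Sum>k. p x * u k x)) (at x within ?S)"
    by blast
  have zh: "z x = z0 + h x" if "x \<in> ?S" for x
    unfolding z_def using suminf_split_head[OF sv[OF that]] sums_unique[OF h(1)[OF that]] by (simp add: uv0)
  have py: "(\<Sum>k. p x * u k x) = p x * y x" if "x \<in> ?S" for x
    unfolding y_def using suminf_mult[OF su[OF that]] .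
  show ?thesis
  proof (rule that)
    show "y c = y0" using yg[OF c] sums_unique2[OF g(1)[OF c]] uc(1) by (simp add: sums_zero)
    show "z c = z0" using zh[OF c] sums_unique2[OF h(1)[OF c]] uc(2) by (simp add: sums_zero)
    fix x assume x: "x \<in> ?S"
    have "((\<lambda>x. y0 + g x) has_real_derivative z x) (at x within ?S)"
      using g(2)[OF x] by (auto intro!: derivative_eq_intros)
    then show "(y has_real_derivative z x) (at x within ?S)"
      by (rule has_field_derivative_transform_within[OF _ zero_less_one x]) (simp add: yg)
    have "((\<lambda>x. z0 + h x) has_real_derivative p x * y x) (at x within ?S)"
      using h(2)[OF x] by (auto intro!: derivative_eq_intros simp: py[OF x])
    then show "(z has_real_derivative p x * y x) (at x within ?S)"
      by (rule has_field_derivative_transform_within[OF _ zero_less_one x]) (simp add: zh)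
  qed
qed

subsection \<open>Sturm--Liouville perturbation of the sine\<close>

text \<open>Gronwall estimate: \<open>(e s)\<^sup>2 + (e' s)\<^sup>2 + \<beta>\<^sup>2\<close>,
  damped at rate \<open>K + 2\<close>, is nonincreasing. Carrying \<open>\<beta>\<^sup>2\<close> in
  the energy absorbs the forcing. The estimate serves both to compare a solution with a sine and to
  compare solutions for nearby spectral parameters.\<close>

lemma perturbation_bound:
  fixes e e' A b :: "real \<Rightarrow> real"
  assumes e: "\<And>s. s \<in> {0..1} \<Longrightarrow> (e has_real_derivative e' s) (at s within {0..1})"
    and e': "\<And>s. s \<in> {0..1} \<Longrightarrow> (e' has_real_derivative A s * e s + b s) (at s within {0..1})"
    and "e 0 = 0" "e' 0 = 0" "0 \<le> K" "0 \<le> \<beta>"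
    and A: "\<And>s. s \<in> {0..1} \<Longrightarrow> \<bar>A s\<bar> \<le> K" and b: "\<And>s. s \<in> {0..1} \<Longrightarrow> \<bar>b s\<bar> \<le> \<beta>"
    and s: "s \<in> {0..1}"
  shows "\<bar>e s\<bar> \<le> \<beta> * exp (K + 2)" "\<bar>e' s\<bar> \<le> \<beta> * exp (K + 2)"
proof -
  define L where "L = K + 2"
  define N where "N = (\<lambda>s. ((e s)\<^sup>2 + (e' s)\<^sup>2 + \<beta>\<^sup>2) * exp (- (L * s)))"
  note ec = DERIV_continuous_on[OF e] and ec' = DERIV_continuous_on[OF e']
  have "N s \<le> N 0"
  proof (rule DERIV_nonpos_imp_decreasing_open[where f=N and a=0 and b=s])
    show "0 \<le> s" using s by simp
    show "continuous_on {0..s} N"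
      unfolding N_def using s by (intro continuous_intros continuous_on_subset[OF ec] continuous_on_subset[OF ec']) auto
    fix t assume t: "0 < t" "t < s"
    then have t': "t \<in> {0..1}" "at t within {0..1} = at t" using s by (auto simp: at_within_Icc_at)
    let ?d = "2 * e t * e' t + 2 * e' t * (A t * e t + b t) - L * ((e t)\<^sup>2 + (e' t)\<^sup>2 + \<beta>\<^sup>2)"
    have "(N has_real_derivative ?d * exp (- (L * t))) (at t)"
      unfolding N_def using e[OF t'(1)] e'[OF t'(1)] unfolding t'(2)
      by (auto intro!: derivative_eq_intros simp: algebra_simps power2_eq_square)
    moreover have "?d \<le> 0"
    proof -
      have "2 * e t * e' t \<le> (e t)\<^sup>2 + (e' t)\<^sup>2" by (rule sum_squares_bound)
      moreover have "2 * e' t * (A t * e t) \<le> K * ((e t)\<^sup>2 + (e' t)\<^sup>2)"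
      proof -
        have "2 * e' t * (A t * e t) = A t * (2 * e t * e' t)" by simp
        also have "\<dots> \<le> \<bar>A t\<bar> * \<bar>2 * e t * e' t\<bar>" by (metis abs_ge_self abs_mult)
        also have "\<dots> \<le> K * ((e t)\<^sup>2 + (e' t)\<^sup>2)"
        proof (intro mult_mono A t')
          show "\<bar>2 * e t * e' t\<bar> \<le> (e t)\<^sup>2 + (e' t)\<^sup>2"
            using sum_squares_bound[of "e t" "e' t"] sum_squares_bound[of "e t" "- e' t"] by (auto simp: abs_le_iff)
        qed (use assms in auto)
        finally show ?thesis .
      qed
      moreover have "2 * e' t * b t \<le> (e' t)\<^sup>2 + (b t)\<^sup>2" by (rule sum_squares_bound)
      moreover have "(b t)\<^sup>2 \<le> \<beta>\<^sup>2"
        using b[OF t'(1)] \<open>0 \<le> \<beta>\<close> by (metis abs_le_square_iff abs_of_nonneg)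
      moreover have "0 \<le> (e t)\<^sup>2" "0 \<le> K * \<beta>\<^sup>2" "0 \<le> \<beta>\<^sup>2" using \<open>0 \<le> K\<close> by auto
      moreover have "?d = 2 * e t * e' t + 2 * e' t * (A t * e t) + 2 * e' t * b t
          - (K * ((e t)\<^sup>2 + (e' t)\<^sup>2) + K * \<beta>\<^sup>2 + 2 * (e t)\<^sup>2 + 2 * (e' t)\<^sup>2 + 2 * \<beta>\<^sup>2)"
        by (simp add: L_def algebra_simps)
      ultimately show ?thesis by linarith
    qed
    ultimately show "\<exists>y. DERIV N t :> y \<and> y \<le> 0"
      by (intro exI conjI) (auto simp: mult_nonpos_nonneg)
  qed
  then have "(e s)\<^sup>2 + (e' s)\<^sup>2 + \<beta>\<^sup>2 \<le> \<beta>\<^sup>2 * exp (L * s)"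
    by (simp add: N_def assms exp_minus field_simps)
  also have "\<dots> \<le> \<beta>\<^sup>2 * (exp L)\<^sup>2"
  proof (intro mult_left_mono)
    have "0 \<le> L" using \<open>0 \<le> K\<close> by (simp add: L_def)
    moreover from this have "L * s \<le> L * 1" using s by (intro mult_left_mono) auto
    ultimately have "exp (L * s) \<le> exp (2 * L)" by (intro iffD2[OF exp_le_cancel_iff]) linarith
    then show "exp (L * s) \<le> (exp L)\<^sup>2" by (simp only: exp_double)
  qed simp
  finally have *: "(e s)\<^sup>2 + (e' s)\<^sup>2 + \<beta>\<^sup>2 \<le> (\<beta> * exp L)\<^sup>2" by (simp add: power_mult_distrib)
  have "(e s)\<^sup>2 \<le> (\<beta> * exp L)\<^sup>2" "(e' s)\<^sup>2 \<le> (\<beta> * exp L)\<^sup>2"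
    using * zero_le_power2[of "e s"] zero_le_power2[of "e' s"] zero_le_power2[of \<beta>] by linarith+
  then have "\<bar>e s\<bar> \<le> \<bar>\<beta> * exp L\<bar>" "\<bar>e' s\<bar> \<le> \<bar>\<beta> * exp L\<bar>"
    by (simp_all only: abs_le_square_iff)
  moreover have "\<bar>\<beta> * exp L\<bar> = \<beta> * exp L" using \<open>0 \<le> \<beta>\<close> by simp
  ultimately show "\<bar>e s\<bar> \<le> \<beta> * exp (K + 2)" "\<bar>e' s\<bar> \<le> \<beta> * exp (K + 2)"
    by (simp_all only: L_def)
qed

section \<open>Signs of functions close to a sine wave\<close>

lemma sin_ge_half: "1/2 \<le> sin x" if "pi/6 \<le> x" "x \<le> 5*pi/6"
proof (cases "x \<le> pi/2")
  case True
  then show ?thesis using sin_monotone_2pi_le[of "pi/6" x] that by (simp add: sin_30)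
next
  case False
  then show ?thesis using sin_monotone_2pi_le[of "pi/6" "pi - x"] that by (simp add: sin_30)
qed

lemma cos_ge_half: "1/2 \<le> cos x" if "- pi/3 \<le> x" "x \<le> pi/3"
  using sin_ge_half[of "pi/2 - x"] that by (simp add: cos_sin_eq)

lemma cos_le_minus_half: "cos x \<le> -1/2" if "2*pi/3 \<le> x" "x \<le> 4*pi/3"
  using cos_ge_half[of "x - pi"] that by simp

lemma sin_le_minus_half: "sin x \<le> -1/2" if "7*pi/6 \<le> x" "x \<le> 11*pi/6"
  using sin_ge_half[of "x - pi"] that by simp

lemma cos_ge_half': "1/2 \<le> cos x" if "5*pi/3 \<le> x" "x \<le> 7*pi/3"
  using cos_ge_half[of "x - 2*pi"] that by (simp add: cos_diff)

text \<open>The sectors of phases \<open>\<mu> * s\<close> where sine or cosine has modulus at least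
  1/2 cover the circle. In the sine sectors the tolerance 1/100 fixes the sign of \<open>y\<close>,
  since \<open>\<mu> < 10\<close> makes the model at least 1/20 in size; in the cosine sectors it
  makes \<open>y\<close> strictly monotone. Near the ends, where the model is small, the sign comes
  from monotonicity and the exact zeros at 0 and 1.\<close>

locale near_sine =
  fixes y z :: "real \<Rightarrow> real" and \<mu> :: real
  assumes y: "\<And>s. s \<in> {0..1} \<Longrightarrow> (y has_real_derivative z s) (at s within {0..1})"
    and y0: "y 0 = 0" and y1: "y 1 = 0"
    and \<mu>: "1 \<le> \<mu>" "\<mu> < 10"
    and ny: "\<And>s. s \<in> {0..1} \<Longrightarrow> \<bar>y s - sin (\<mu> * s) / \<mu>\<bar> \<le> 1/100"
    and nz: "\<And>s. s \<in> {0..1} \<Longrightarrow> \<bar>z s - cos (\<mu> * s)\<bar> \<le> 1/100"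
begin

lemma cont: "continuous_on {0..1} y"
  by (rule DERIV_continuous_on[OF y])

lemma increasing:
  assumes "0 \<le> a" "a < b" "b \<le> 1" "\<And>x. a < x \<Longrightarrow> x < b \<Longrightarrow> 1/2 \<le> cos (\<mu> * x)"
  shows "y a < y b"
proof (rule DERIV_pos_imp_increasing_open[where f=y and a=a and b=b])
  fix x assume x: "a < x" "x < b"
  then have "(y has_real_derivative z x) (at x)"
    using y[of x] assms by (auto simp: at_within_Icc_at)
  moreover have "z x > 0"
    using nz[of x] x assms(1-3) assms(4)[OF x] unfolding atLeastAtMost_iff by linarith
  ultimately show "\<exists>d. DERIV y x :> d \<and> 0 < d" by blast
qed (use assms cont in \<open>auto intro: continuous_on_subset\<close>)

lemma decreasing:
  assumes "0 \<le> a" "a < b" "b \<le> 1" "\<And>x. a < x \<Longrightarrow> x < b \<Longrightarrow> cos (\<mu> * x) \<le> -1/2"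
  shows "y b < y a"
proof (rule DERIV_neg_imp_decreasing_open[where f=y and a=a and b=b])
  fix x assume x: "a < x" "x < b"
  then have "(y has_real_derivative z x) (at x)"
    using y[of x] assms by (auto simp: at_within_Icc_at)
  moreover have "z x < 0"
    using nz[of x] x assms(1-3) assms(4)[OF x] unfolding atLeastAtMost_iff by linarith
  ultimately show "\<exists>d. DERIV y x :> d \<and> d < 0" by blast
qed (use assms cont in \<open>auto intro: continuous_on_subset\<close>)

lemma pos_of_sin: "0 < y s" if "s \<in> {0..1}" "1/2 \<le> sin (\<mu> * s)"
proof -
  have "1/20 \<le> sin (\<mu> * s) / \<mu>" using that(2) \<mu> by (simp add: field_simps)
  then show ?thesis using ny[OF that(1)] by linarith
qed

lemma neg_of_sin: "y s < 0" if "s \<in> {0..1}" "sin (\<mu> * s) \<le> -1/2"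
proof -
  have "sin (\<mu> * s) / \<mu> \<le> -1/20" using that(2) \<mu> by (simp add: field_simps)
  then show ?thesis using ny[OF that(1)] by linarith
qed

lemma pos_start: "0 < y s" if s: "0 < s" "s \<le> 1" "\<mu> * s \<le> 2*pi/3"
proof (cases "\<mu> * s \<le> pi/3")
  case True
  have "1/2 \<le> cos (\<mu> * x)" if "0 < x" "x < s" for x
  proof (rule cos_ge_half)
    have "\<mu> * x \<le> \<mu> * s" "0 < \<mu> * x" using that \<mu> by auto
    then show "- pi/3 \<le> \<mu> * x" "\<mu> * x \<le> pi/3" using True pi_gt_zero by linarith+
  qed
  then show ?thesis using increasing[of 0 s] s y0 by auto
next
  case False
  then show ?thesis using s by (intro pos_of_sin sin_ge_half) auto
qed

lemma decreasing_middle: "y b < y a" if "0 \<le> a" "a < b" "b \<le> 1" "2*pi/3 \<le> \<mu> * a" "\<mu> * b \<le> 4*pi/3"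
proof (rule decreasing[OF that(1-3)])
  fix x assume x: "a < x" "x < b"
  then have "\<mu> * a \<le> \<mu> * x" "\<mu> * x \<le> \<mu> * b" using \<mu> by auto
  then show "cos (\<mu> * x) \<le> -1/2" using that by (intro cos_le_minus_half) auto
qed

text \<open>Beyond phase \<open>2*pi/3\<close> the function decreases to its exact zero at 1; the
  bound on \<open>\<mu>\<close> keeps the remaining phases in the decreasing sector.\<close>

lemma pos_first:
  assumes "\<mu> \<le> 4*pi/3" "0 < s" "s < 1"
  shows "0 < y s"
proof (cases "\<mu> * s \<le> 2*pi/3")
  case True
  then show ?thesis using pos_start assms by auto
next
  case False
  then show ?thesis using decreasing_middle[of s 1] assms y1 by auto
qed

text \<open>The interior zero is never located. Beyond phase \<open>4*pi/3\<close> the function is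
  nonpositive: by size up to \<open>5*pi/3\<close>, afterwards because it rises to its zero at 1.
  Before that phase it is on the initial positive stretch or decreasing, so positivity propagates
  backwards, which is the form that Sturm comparison consumes.\<close>

lemma second_pos_before:
  assumes "5*pi/3 \<le> \<mu>" "\<mu> \<le> 7*pi/3" "0 < t" "t \<le> s" "s \<le> 1" "0 < y s"
  shows "0 < y t"
proof -
  have "\<mu> * s < 4*pi/3"
  proof (rule ccontr)
    assume n: "\<not> ?thesis"
    have "y s \<le> 0"
    proof (cases "\<mu> * s \<le> 5*pi/3")
      case True
      then have "y s < 0" using n assms by (intro neg_of_sin sin_le_minus_half) auto
      then show ?thesis by simp
    next
      case False
      have "y s < y 1" if "s < 1"
      proof (rule increasing)
        fix x assume x: "s < x" "x < 1"
        have "\<mu> * s \<le> \<mu> * x" "\<mu> * x \<le> \<mu> * 1" using \<mu> x by (auto intro!: mult_left_mono)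
        then show "1/2 \<le> cos (\<mu> * x)" using assms False by (intro cos_ge_half') auto
      qed (use assms that in auto)
      then show ?thesis using y1 assms by fastforce
    qed
    then show False using assms by simp
  qed
  show ?thesis
  proof (cases "\<mu> * t \<le> 2*pi/3")
    case True
    then show ?thesis using pos_start assms by auto
  next
    case False
    then show ?thesis
      using decreasing_middle[of t s] assms \<open>\<mu> * s < 4*pi/3\<close> by (cases "t = s") auto
  qed
qed

text \<open>The point has phase \<open>3*pi/2\<close>, the trough of the sine. It later witnesses
  that the profiles differ, hence that the initial Laplacian is not identically zero.\<close>

lemma second_neg:
  assumes "5*pi/3 \<le> \<mu>"
  shows "y (3*pi/(2*\<mu>)) < 0" "3*pi/(2*\<mu>) \<in> {0<..<1}"
proof -
  show *: "3*pi/(2*\<mu>) \<in> {0<..<1}" using assms \<mu> pi_gt_zero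
    by (auto simp: field_simps)
  have "\<mu> * (3*pi/(2*\<mu>)) = 3*pi/2" using \<mu> by simp
  then show "y (3*pi/(2*\<mu>)) < 0" using * by (intro neg_of_sin sin_le_minus_half) auto
qed

end

text \<open>Sturm comparison: the Wronskian makes \<open>y2 / y1\<close> nonincreasing as long as both are positive.\<close>

lemma sturm_comparison:
  fixes y1 z1 y2 z2 q :: "real \<Rightarrow> real"
  assumes "0 < s" "s < 1" "l1 \<le> l2"
    and y1: "\<And>t. t \<in> {0..1} \<Longrightarrow> (y1 has_real_derivative z1 t) (at t within {0..1})"
    and z1: "\<And>t. t \<in> {0..1} \<Longrightarrow> (z1 has_real_derivative (q t - l1) * y1 t) (at t within {0..1})"
    and y2: "\<And>t. t \<in> {0..1} \<Longrightarrow> (y2 has_real_derivative z2 t) (at t within {0..1})"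
    and z2: "\<And>t. t \<in> {0..1} \<Longrightarrow> (z2 has_real_derivative (q t - l2) * y2 t) (at t within {0..1})"
    and init: "y1 0 = 0" "y2 0 = 0" "z1 0 = 1" "z2 0 = 1"
    and pos1: "\<And>t. 0 < t \<Longrightarrow> t \<le> s \<Longrightarrow> 0 < y1 t" and pos2: "\<And>t. 0 < t \<Longrightarrow> t \<le> s \<Longrightarrow> 0 < y2 t"
  shows "y2 s \<le> y1 s"
proof -
  have at: "at t within {0..1} = at t" if "0 < t" "t \<le> s" for t :: real
    using that assms(2) by (simp add: at_within_Icc_at)
  note c = DERIV_continuous_on[OF y1] DERIV_continuous_on[OF z1] DERIV_continuous_on[OF y2] DERIV_continuous_on[OF z2]
  \<comment> \<open>The derivative of the Wronskian is \<open>(l1 - l2) * (y1 x * y2 x)\<close>,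
    because the common potential \<open>q\<close> cancels.\<close>
  define W where "W = (\<lambda>t. y1 t * z2 t - z1 t * y2 t)"
  have W: "W t \<le> 0" if "0 < t" "t \<le> s" for t
  proof -
    have "W t \<le> W 0"
    proof (rule DERIV_nonpos_imp_decreasing_open[where f=W and a=0 and b=t])
      show "continuous_on {0..t} W" unfolding W_def
        using that assms(2) by (intro continuous_intros c[THEN continuous_on_subset]) auto
      fix x assume x: "0 < x" "x < t"
      then have x': "x \<in> {0..1}" "at x within {0..1} = at x" using at that assms(2) by auto
      have "(W has_real_derivative (l1 - l2) * (y1 x * y2 x)) (at x)"
        unfolding W_def using y1[OF x'(1)] y2[OF x'(1)] z1[OF x'(1)] z2[OF x'(1)] unfolding x'(2)
        by (auto intro!: derivative_eq_intros simp: algebra_simps)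
      moreover have "(l1 - l2) * (y1 x * y2 x) \<le> 0"
        using pos1[of x] pos2[of x] x that assms(3) by (simp add: mult_nonpos_nonneg)
      ultimately show "\<exists>d. DERIV W x :> d \<and> d \<le> 0" by blast
    qed (use that in auto)
    then show ?thesis by (simp add: W_def init)
  qed
  define r where "r = (\<lambda>t. y2 t / y1 t)"
  have mono: "r s \<le> r t" if "0 < t" "t < s" for t
  proof (rule DERIV_nonpos_imp_decreasing_open[where f=r and a=t and b=s])
    have "\<And>x. x \<in> {t..s} \<Longrightarrow> y1 x \<noteq> 0"
      by (metis atLeastAtMost_iff less_irrefl order_less_le_trans pos1 that(1))
    then show "continuous_on {t..s} r" unfolding r_def
      using that assms(2) by (intro continuous_intros c[THEN continuous_on_subset]) auto
    fix x assume x: "t < x" "x < s"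
    then have x': "x \<in> {0..1}" "at x within {0..1} = at x" using at that assms(2) by auto
    have "(r has_real_derivative W x / (y1 x * y1 x)) (at x)"
      unfolding r_def using y1[OF x'(1)] y2[OF x'(1)] pos1[of x] x that unfolding x'(2)
      by (auto intro!: derivative_eq_intros simp: W_def algebra_simps)
    moreover have "W x / (y1 x * y1 x) \<le> 0"
      using W[of x] x that by (intro divide_nonpos_nonneg) auto
    ultimately show "\<exists>d. DERIV r x :> d \<and> d \<le> 0" by blast
  qed (use that in auto)
  \<comment> \<open>Both functions vanish at 0 with slope 1, so the nonincreasing ratio starts from
    the limit 1.\<close>
  have "((\<lambda>t. y1 t / t) \<longlongrightarrow> 1) (at 0 within {0..1})" "((\<lambda>t. y2 t / t) \<longlongrightarrow> 1) (at 0 within {0..1})"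
    using y1[of 0] y2[of 0] by (auto simp: has_field_derivative_iff init)
  then have "((\<lambda>t. (y2 t / t) / (y1 t / t)) \<longlongrightarrow> 1 / 1) (at 0 within {0..1})"
    by (intro tendsto_divide) auto
  then have lim: "((\<lambda>t. (y2 t / t) / (y1 t / t)) \<longlongrightarrow> 1) (at_right 0)"
    by (simp add: at_within_Icc_at_right)
  have "r s \<le> 1"
  proof (rule tendsto_lowerbound[OF lim])
    have "eventually (\<lambda>t. t \<in> {0<..<s}) (at_right 0)"
      using assms(1) by (rule eventually_at_right_real)
    then show "eventually (\<lambda>t. r s \<le> (y2 t / t) / (y1 t / t)) (at_right 0)"
      by (rule eventually_mono) (use mono in \<open>auto simp: r_def\<close>)
  qed auto
  then show ?thesis using pos1[of s] assms(1) by (simp add: r_def)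
qed

text \<open>The bound on \<open>q\<close> comes from \<open>perturbation_bound\<close> with \<open>K = 101\<close>, which dominates
  \<open>\<bar>q - \<mu>\<^sup>2\<bar>\<close> for \<open>\<mu> < 10\<close>. Near \<open>\<mu> = pi\<close> and \<open>\<mu> = 2 pi\<close> the value at \<open>1\<close> changes sign,
  which yields the two eigenvalues.\<close>

lemma two_eigenfunctions:
  fixes q :: "real \<Rightarrow> real"
  assumes q: "continuous_on {-1/2..3/2} q" and small: "\<And>s. s \<in> {0..1} \<Longrightarrow> \<bar>q s\<bar> \<le> exp (- 103) / 100"
  obtains l1 l2 y1 z1 y2 z2 where "0 < l1" "l1 < l2"
    "\<forall>s\<in>{-1/2..3/2}. (y1 has_real_derivative z1 s) (at s within {-1/2..3/2}) \<and>
       (z1 has_real_derivative (q s - l1) * y1 s) (at s within {-1/2..3/2})"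
    "\<forall>s\<in>{-1/2..3/2}. (y2 has_real_derivative z2 s) (at s within {-1/2..3/2}) \<and>
       (z2 has_real_derivative (q s - l2) * y2 s) (at s within {-1/2..3/2})"
    "y1 0 = 0" "y2 0 = 0" "z1 0 = 1" "z2 0 = 1" "y1 1 = 0" "y2 1 = 0"
    "\<forall>s\<in>{0..1}. y2 s \<le> y1 s" "\<exists>s\<in>{0<..<1}. y2 s < y1 s"
proof -
  \<comment> \<open>Solutions reach beyond \<open>{0..1}\<close> so that the radial profiles live on
    a neighbourhood of the closed ring; the estimates take place on \<open>{0..1}\<close>.\<close>
  let ?I = "{-1/2..3/2::real}"
  have "\<exists>y z. y 0 = 0 \<and> z 0 = 1 \<and> (\<forall>s\<in>?I. (y has_real_derivative z s) (at s within ?I)) \<and>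
      (\<forall>s\<in>?I. (z has_real_derivative (q s - l) * y s) (at s within ?I))" for l
  proof -
    have "continuous_on ?I (\<lambda>s. q s - l)" by (intro continuous_intros q)
    then obtain y z where "y 0 = 0" "z 0 = 1"
      "\<And>s. s \<in> ?I \<Longrightarrow> (y has_real_derivative z s) (at s within ?I)"
      "\<And>s. s \<in> ?I \<Longrightarrow> (z has_real_derivative (q s - l) * y s) (at s within ?I)"
      using linear_second_order_ivp[of 0 "-1/2" "3/2" "\<lambda>s. q s - l" 0 1] by auto
    then show ?thesis by blast
  qed
  then obtain y z where init: "\<And>l. y l 0 = 0" "\<And>l. z l 0 = 1"
    and y: "\<And>l s. s \<in> ?I \<Longrightarrow> (y l has_real_derivative z l s) (at s within ?I)"
    and z: "\<And>l s. s \<in> ?I \<Longrightarrow> (z l has_real_derivative (q s - l) * y l s) (at s within ?I)"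
    by metis
  have sub: "{0..1} \<subseteq> ?I" by auto
  have y': "(y l has_real_derivative z l s) (at s within {0..1})"
    and z': "(z l has_real_derivative (q s - l) * y l s) (at s within {0..1})" if "s \<in> {0..1}" for l s
    using y[of s l] z[of s l] that sub by (auto intro: DERIV_subset)
  define \<delta> :: real where "\<delta> = exp (- 103) / 100"
  have \<delta>: "0 < \<delta>" "\<delta> \<le> 1" "\<delta> * exp 103 = 1/100"
    by (auto simp: \<delta>_def exp_minus field_simps) (use exp_ge_add_one_self[of "103::real"] in linarith)
  have near: "\<bar>y (\<mu>\<^sup>2) s - sin (\<mu> * s) / \<mu>\<bar> \<le> 1/100" "\<bar>z (\<mu>\<^sup>2) s - cos (\<mu> * s)\<bar> \<le> 1/100"
    if \<mu>: "1 \<le> \<mu>" "\<mu> < 10" and s: "s \<in> {0..1}" for \<mu> s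
  proof -
    have \<mu>2: "\<mu>\<^sup>2 \<le> 100" using \<mu> power_mono[of \<mu> 10 2] by simp
    \<comment> \<open>\<open>?e\<close> is the difference from the solution of the free equation
      with the same initial data; it solves the full equation with forcing
      \<open>q s * (sin (\<mu> * s) / \<mu>)\<close>, of size at most
      \<open>\<delta>\<close>.\<close>
    let ?e = "\<lambda>s. y (\<mu>\<^sup>2) s - sin (\<mu> * s) / \<mu>" and ?e' = "\<lambda>s. z (\<mu>\<^sup>2) s - cos (\<mu> * s)"
    note bound = perturbation_bound[where e = ?e and e' = ?e' and K = 101 and \<beta> = \<delta>
        and A = "\<lambda>s. q s - \<mu>\<^sup>2" and b = "\<lambda>s. q s * (sin (\<mu> * s) / \<mu>)"]
    have d1: "(?e has_real_derivative ?e' s) (at s within {0..1})" if s: "s \<in> {0..1}" for s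
      using \<mu> by (auto intro!: derivative_eq_intros y'[OF s])
    have d2: "(?e' has_real_derivative (q s - \<mu>\<^sup>2) * ?e s + q s * (sin (\<mu> * s) / \<mu>)) (at s within {0..1})"
      if s: "s \<in> {0..1}" for s
      using \<mu> by (auto intro!: derivative_eq_intros z'[OF s] simp: field_simps power2_eq_square)
    have d3: "\<bar>q s - \<mu>\<^sup>2\<bar> \<le> 101" if s: "s \<in> {0..1}" for s
      using small[OF s] \<mu>2 \<delta>(2) unfolding \<delta>_def[symmetric] by (smt (verit) zero_le_power2)
    have d4: "\<bar>q s * (sin (\<mu> * s) / \<mu>)\<bar> \<le> \<delta>" if s: "s \<in> {0..1}" for s
    proof -
      have "\<bar>sin (\<mu> * s) / \<mu>\<bar> \<le> 1"
        using \<mu> order_trans[OF abs_sin_le_one[of "\<mu> * s"] \<mu>(1)] by (simp add: divide_le_eq)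
      then show ?thesis
        using small[OF s] \<delta>(1) unfolding \<delta>_def[symmetric] abs_mult by (smt (verit) abs_ge_zero mult_left_le)
    qed
    have d5: "?e 0 = 0" "?e' 0 = 0" using init by auto
    have d6: "\<delta> * exp (101 + 2) = 1/100" using \<delta>(3) by simp
    show "\<bar>?e s\<bar> \<le> 1/100"
      unfolding d6[symmetric] by (rule bound(1)) (rule d1 d2 d3 d4 d5 s | assumption | simp add: \<delta>(1) less_imp_le)+
    show "\<bar>?e' s\<bar> \<le> 1/100"
      unfolding d6[symmetric] by (rule bound(2)) (rule d1 d2 d3 d4 d5 s | assumption | simp add: \<delta>(1) less_imp_le)+
  qed
  \<comment> \<open>The difference of the solutions for \<open>k\<close> and \<open>l\<close> solves
    the equation for \<open>k\<close> with forcing \<open>(l - k) * y l s\<close>, which tends to 0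
    as \<open>k\<close> tends to \<open>l\<close>.\<close>
  have cont_l: "isCont (\<lambda>l. y l 1) l" for l
  proof -
    have "continuous_on {0..1} (y l)" by (rule DERIV_continuous_on[of _ "y l" "z l"]) (rule y')
    then have "bounded (y l ` {0..1})"
      by (intro compact_imp_bounded compact_continuous_image) auto
    then obtain B where "\<forall>x\<in>y l ` {0..1}. norm x \<le> B" unfolding bounded_iff by blast
    then have B: "\<bar>y l s\<bar> \<le> B" if "s \<in> {0..1}" for s using that unfolding real_norm_def by blast
    have B0: "0 \<le> B" using B[of 0] by force
    have "\<bar>y k 1 - y l 1\<bar> \<le> (\<bar>k - l\<bar> * B) * exp (\<bar>l\<bar> + 2 + 2)" if "\<bar>k - l\<bar> < 1" for k
    proof (rule perturbation_bound(1)[where e="\<lambda>s. y k s - y l s" and e'="\<lambda>s. z k s - z l s" and A="\<lambda>s. q s - k" and b="\<lambda>s. (l - k) * y l s"])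
      fix s :: real assume s: "s \<in> {0..1}"
      show "((\<lambda>s. y k s - y l s) has_real_derivative z k s - z l s) (at s within {0..1})"
        by (auto intro!: derivative_eq_intros y'[OF s])
      show "((\<lambda>s. z k s - z l s) has_real_derivative (q s - k) * (y k s - y l s) + (l - k) * y l s) (at s within {0..1})"
        by (auto intro!: derivative_eq_intros z'[OF s] simp: algebra_simps)
      show "\<bar>q s - k\<bar> \<le> \<bar>l\<bar> + 2"
        using small[OF s] \<delta>(2) that unfolding \<delta>_def[symmetric] by linarith
      show "\<bar>(l - k) * y l s\<bar> \<le> \<bar>k - l\<bar> * B"
        unfolding abs_mult using B[OF s] by (intro mult_mono) auto
    qed (use init B0 in auto)
    then have ev: "eventually (\<lambda>k. norm (y k 1 - y l 1) \<le> (\<bar>k - l\<bar> * B) * exp (\<bar>l\<bar> + 2 + 2)) (at l)"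
      unfolding eventually_at by (intro exI[of _ 1]) (auto simp: dist_real_def)
    have "((\<lambda>k. (\<bar>k - l\<bar> * B) * exp (\<bar>l\<bar> + 2 + 2)) \<longlongrightarrow> (\<bar>l - l\<bar> * B) * exp (\<bar>l\<bar> + 2 + 2)) (at l)"
      by (intro tendsto_intros)
    then have "((\<lambda>k. (\<bar>k - l\<bar> * B) * exp (\<bar>l\<bar> + 2 + 2)) \<longlongrightarrow> 0) (at l)" by simp
    with ev have "((\<lambda>k. y k 1 - y l 1) \<longlongrightarrow> 0) (at l)" by (rule Lim_null_comparison)
    then show ?thesis using LIM_zero_iff[of "\<lambda>k. y k 1" "y l 1"] unfolding isCont_def by blast
  qed
  have cont_\<mu>: "continuous_on S (\<lambda>\<mu>. y (\<mu>\<^sup>2) 1)" for S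
  proof -
    have "continuous_on UNIV (\<lambda>l. y l 1)" using cont_l by (blast intro: continuous_at_imp_continuous_on)
    moreover have "continuous_on S (\<lambda>\<mu>::real. \<mu>\<^sup>2)" by (intro continuous_intros)
    ultimately show ?thesis by (rule continuous_on_compose2) simp
  qed
  have pi: "pi < 4" "3 < pi" using pi_less_4 pi_gt3 by auto
  have pos: "0 \<le> y (\<mu>\<^sup>2) 1" if "1 \<le> \<mu>" "\<mu> < 10" "1/2 \<le> sin \<mu>" for \<mu>
  proof -
    have "1/20 \<le> sin \<mu> / \<mu>" using that by (simp add: field_simps)
    moreover have "\<bar>y (\<mu>\<^sup>2) 1 - sin \<mu> / \<mu>\<bar> \<le> 1/100" using near(1)[of \<mu> 1] that(1,2) by simp
    ultimately show ?thesis by linarith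
  qed
  have neg: "y (\<mu>\<^sup>2) 1 \<le> 0" if "1 \<le> \<mu>" "\<mu> < 10" "sin \<mu> \<le> -1/2" for \<mu>
  proof -
    have "sin \<mu> / \<mu> \<le> -1/20" using that by (simp add: field_simps)
    moreover have "\<bar>y (\<mu>\<^sup>2) 1 - sin \<mu> / \<mu>\<bar> \<le> 1/100" using near(1)[of \<mu> 1] that(1,2) by simp
    ultimately show ?thesis by linarith
  qed
  \<comment> \<open>At the ends of both brackets the sine has modulus \<open>sqrt 3 / 2\<close>,
    well above the tolerance. The brackets lie in the ranges of \<open>pos_first\<close> and
    \<open>second_pos_before\<close>; being disjoint, they give \<open>m1 < m2\<close>.\<close>
  obtain m1 where m1: "2*pi/3 \<le> m1" "m1 \<le> 4*pi/3" "y (m1\<^sup>2) 1 = 0"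
    using IVT2'[of "\<lambda>\<mu>. y (\<mu>\<^sup>2) 1" "4*pi/3" 0 "2*pi/3"] cont_\<mu> pi
      pos[of "2*pi/3"] neg[of "4*pi/3"] sin_ge_half[of "2*pi/3"] sin_le_minus_half[of "4*pi/3"] by auto
  have "sin (7*pi/3) = sin (pi/3)"
    using sin_periodic[of "pi/3"] by (simp add: field_simps)
  then have s7: "1/2 \<le> sin (7*pi/3)" using sin_ge_half[of "pi/3"] by simp
  obtain m2 where m2: "5*pi/3 \<le> m2" "m2 \<le> 7*pi/3" "y (m2\<^sup>2) 1 = 0"
    using IVT'[of "\<lambda>\<mu>. y (\<mu>\<^sup>2) 1" "5*pi/3" 0 "7*pi/3"] cont_\<mu> pi
      pos[OF _ _ s7] neg[of "5*pi/3"] sin_le_minus_half[of "5*pi/3"] by auto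
  interpret n1: near_sine "y (m1\<^sup>2)" "z (m1\<^sup>2)" m1
    using y' init m1 near pi by unfold_locales auto
  interpret n2: near_sine "y (m2\<^sup>2)" "z (m2\<^sup>2)" m2
    using y' init m2 near pi by unfold_locales auto
  have lt: "m1\<^sup>2 < m2\<^sup>2" using m1 m2 pi by (intro power_strict_mono) auto
  have p1: "0 \<le> y (m1\<^sup>2) s" if "s \<in> {0..1}" for s
    using n1.pos_first[OF m1(2), of s] that n1.y0 n1.y1 by (cases "s = 0"; cases "s = 1") auto
  have le: "y (m2\<^sup>2) s \<le> y (m1\<^sup>2) s" if s: "s \<in> {0..1}" for s
  proof (cases "y (m2\<^sup>2) s \<le> 0")
    case True
    then show ?thesis using p1[OF s] by simp
  next
    case False
    then have s': "0 < s" "s < 1" using s n2.y0 n2.y1 by (cases "s = 0"; cases "s = 1"; auto)+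
    show ?thesis
    proof (rule sturm_comparison[OF s' less_imp_le[OF lt] y' z' y' z'])
      fix t assume "0 < t" "t \<le> s"
      then show "0 < y (m1\<^sup>2) t" "0 < y (m2\<^sup>2) t"
        using n1.pos_first[OF m1(2), of t] n2.second_pos_before[OF m2(1,2), of t s] s' False by auto
    qed (use init in auto)
  qed
  show ?thesis
  proof (rule that[of "m1\<^sup>2" "m2\<^sup>2" "y (m1\<^sup>2)" "z (m1\<^sup>2)" "y (m2\<^sup>2)" "z (m2\<^sup>2)"])
    show "0 < m1\<^sup>2" using n1.\<mu> by simp
    show "\<exists>s\<in>{0<..<1}. y (m2\<^sup>2) s < y (m1\<^sup>2) s"
    proof (intro bexI)
      show "3*pi/(2*m2) \<in> {0<..<1}" by (rule n2.second_neg(2)[OF m2(1)])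
      then show "y (m2\<^sup>2) (3*pi/(2*m2)) < y (m1\<^sup>2) (3*pi/(2*m2))"
        using n2.second_neg(1)[OF m2(1)] p1[of "3*pi/(2*m2)"] by auto
    qed
  qed (use init y z m1 m2 lt le in auto)
qed

subsection \<open>Smooth and radial functions\<close>

lemma dir_deriv_eq: "(f has_derivative D) (at x) \<Longrightarrow> dir_deriv v f x = D v"
  unfolding dir_deriv_def using frechet_derivative_at by metis

lemma dir_deriv_cong:
  assumes "open U" "x \<in> U" "\<And>y. y \<in> U \<Longrightarrow> f y = g y"
  shows "dir_deriv v f x = dir_deriv v g x"
proof -
  have "(f has_derivative D) (at x) \<longleftrightarrow> (g has_derivative D) (at x)" for D
    using has_derivative_transform_within_open[of f D x UNIV U g]
      has_derivative_transform_within_open[of g D x UNIV U f] assms by auto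
  then show ?thesis unfolding dir_deriv_def frechet_derivative_def by simp
qed

lemma Ck_on_cong:
  assumes "open U" "\<And>x. x \<in> U \<Longrightarrow> f x = g x" "Ck_on k U f"
  shows "Ck_on k U g"
  using assms(2,3)
proof (induction k arbitrary: f g)
  case 0
  then show ?case using continuous_on_cong[of U U f g] by simp
next
  case (Suc k)
  have "g differentiable (at x)" if "x \<in> U" for x
  proof -
    obtain D where "(f has_derivative D) (at x)" using Suc.prems(2) \<open>x \<in> U\<close> by (auto simp: differentiable_def)
    then have "(g has_derivative D) (at x)"
      using has_derivative_transform_within_open[of f D x UNIV U g] assms(1) Suc.prems(1) \<open>x \<in> U\<close> by auto
    then show ?thesis by (auto simp: differentiable_def)
  qed
  moreover have "Ck_on k U (dir_deriv v g)" for v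
  proof (rule Suc.IH)
    show "Ck_on k U (dir_deriv v f)" using Suc.prems by simp
    show "dir_deriv v f x = dir_deriv v g x" if "x \<in> U" for x
      using dir_deriv_cong[OF assms(1) that] Suc.prems(1) by blast
  qed
  ultimately show ?case by simp
qed

lemma Ck_on_linear:
  assumes "open U" "Ck_on k U f" "Ck_on k U g"
  shows "Ck_on k U (\<lambda>x. a * f x + b * g x)"
  using assms(2,3)
proof (induction k arbitrary: f g)
  case 0
  then show ?case by (auto intro!: continuous_intros)
next
  case (Suc k)
  have d: "((\<lambda>x. a * f x + b * g x) has_derivative
      (\<lambda>v. a * frechet_derivative f (at x) v + b * frechet_derivative g (at x) v)) (at x)" if "x \<in> U" for x
    using Suc.prems that frechet_derivative_works by (intro derivative_intros) auto
  have "Ck_on k U (dir_deriv v (\<lambda>x. a * f x + b * g x))" for v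
  proof (rule Ck_on_cong[OF assms(1)])
    show "Ck_on k U (\<lambda>x. a * dir_deriv v f x + b * dir_deriv v g x)"
      using Suc.prems by (intro Suc.IH) auto
  qed (use dir_deriv_eq[OF d] in \<open>auto simp: dir_deriv_def\<close>)
  then show ?case using d by (auto simp: differentiable_def)
qed

text \<open>Exhibiting a set of functions that is stable under directional derivatives, up to
  equality on \<open>U\<close>, takes the place of product and chain rules for the class
  \<open>Ck_on\<close>.\<close>

lemma Ck_on_coinduct:
  assumes "\<And>f x. f \<in> S \<Longrightarrow> x \<in> U \<Longrightarrow> f differentiable (at x)"
    and "\<And>f v. f \<in> S \<Longrightarrow> \<exists>g\<in>S. \<forall>x\<in>U. dir_deriv v f x = g x"
    and "open U" "f \<in> S"
  shows "Ck_on k U f"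
  using assms(4)
proof (induction k arbitrary: f)
  case 0
  then show ?case using assms(1)
    by (auto intro!: continuous_at_imp_continuous_on differentiable_imp_continuous_within)
next
  case (Suc k)
  have "Ck_on k U (dir_deriv v f)" for v
  proof -
    obtain g where "g \<in> S" "\<forall>x\<in>U. dir_deriv v f x = g x" using assms(2)[OF Suc.prems] by blast
    then show ?thesis using Ck_on_cong[OF assms(3), of g "dir_deriv v f"] Suc.IH by auto
  qed
  then show ?case using assms(1)[OF Suc.prems] by simp
qed

section \<open>Slices of space-time functions and the class \<open>C21_on\<close>\<close>

lemma open_slice:
  assumes "open U" shows "open {x. (x, t) \<in> U}"
  using open_vimage[OF assms, of "\<lambda>x. (x, t)"] by (simp add: vimage_def continuous_on_Pair)

lemma slice_derivative:
  assumes "w differentiable (at (x, t))"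
  shows "((\<lambda>y. w (y, t)) has_derivative (\<lambda>v. dir_deriv (v, 0) w (x, t))) (at x)"
    and "((\<lambda>s. w (x, s)) has_derivative (\<lambda>v. dir_deriv (0, v) w (x, t))) (at t)"
proof -
  have d: "(w has_derivative frechet_derivative w (at (x, t))) (at (x, t))"
    using assms frechet_derivative_works by blast
  have "((\<lambda>y. (y, t)) has_derivative (\<lambda>v. (v, 0))) (at x)" "((\<lambda>s. (x, s)) has_derivative (\<lambda>v. (0, v))) (at t)"
    by (auto intro!: derivative_eq_intros)
  from this[THEN diff_chain_at, OF d]
  show "((\<lambda>y. w (y, t)) has_derivative (\<lambda>v. dir_deriv (v, 0) w (x, t))) (at x)"
    "((\<lambda>s. w (x, s)) has_derivative (\<lambda>v. dir_deriv (0, v) w (x, t))) (at t)"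
    by (auto simp: o_def dir_deriv_def)
qed

lemma Ck_on_slice:
  assumes "open U" "Ck_on k U w"
  shows "Ck_on k {x. (x, t) \<in> U} (\<lambda>x. w (x, t))"
  using assms(2)
proof (induction k arbitrary: w)
  case 0
  then show ?case by (auto intro!: continuous_on_compose2[of U w] continuous_intros)
next
  case (Suc k)
  have d: "((\<lambda>y. w (y, t)) has_derivative (\<lambda>v. dir_deriv (v, 0) w (x, t))) (at x)" if "(x, t) \<in> U" for x
    using slice_derivative(1)[of w x t] Suc.prems that by auto
  have "Ck_on k {x. (x, t) \<in> U} (dir_deriv v (\<lambda>y. w (y, t)))" for v
  proof (rule Ck_on_cong[OF open_slice[OF assms(1)]])
    show "Ck_on k {x. (x, t) \<in> U} (\<lambda>x. dir_deriv (v, 0) w (x, t))"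
      using Suc.prems by (intro Suc.IH) auto
  qed (simp add: dir_deriv_eq[OF d])
  then show ?case using d by (auto simp: differentiable_def)
qed

text \<open>Every derivative in \<open>C21_on\<close> is a joint derivative in a direction
  \<open>(axis i 1, 0)\<close> or \<open>(0, 1)\<close>, so the continuity conditions are inherited
  from joint smoothness.\<close>

lemma C21_on_if_Ck_on:
  assumes "open \<Omega>" and u: "\<And>k. Ck_on k (\<Omega> \<times> UNIV) u"
  shows "C21_on \<Omega> u"
proof -
  have slice: "{x. (x, t) \<in> \<Omega> \<times> UNIV} = \<Omega>" for t :: real by auto
  have o: "open (\<Omega> \<times> (UNIV :: real set))" using assms(1) by (intro open_Times) auto
  have sub: "\<Omega> \<times> {0<..} \<subseteq> \<Omega> \<times> (UNIV :: real set)" by auto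
  have diff: "u differentiable (at (x, t))" if "x \<in> \<Omega>" for x t
    using u[of 1] that by (simp add: One_nat_def)
  have diff2: "dir_deriv v u differentiable (at (x, t))" if "x \<in> \<Omega>" for x t v
    using u[of 2] that unfolding numeral_2_eq_2 Ck_on.simps by blast
  have c1: "continuous_on (\<Omega> \<times> UNIV) (dir_deriv v u)" for v
    using u[of "Suc 0"] unfolding Ck_on.simps by (rule conjunct2[THEN spec])
  have c2: "continuous_on (\<Omega> \<times> UNIV) (dir_deriv v (dir_deriv v' u))" for v v'
    using u[of 2] unfolding numeral_2_eq_2 Ck_on.simps by blast
  have dt: "((\<lambda>s. u (x, s)) has_derivative (\<lambda>h. dir_deriv (0, h) u (x, t))) (at t)" if "x \<in> \<Omega>" for x t
    using slice_derivative(2) diff[OF that] by blast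
  have deriv: "deriv (\<lambda>s. u (x, s)) t = dir_deriv (0, 1) u (x, t)" if "x \<in> \<Omega>" for x t
  proof -
    have "(\<lambda>h. dir_deriv (0, h) u (x, t)) = (*) (dir_deriv (0, 1) u (x, t))"
    proof
      show "dir_deriv (0, h) u (x, t) = dir_deriv (0, 1) u (x, t) * h" for h
        using linear_cmul[OF has_derivative_linear[OF dt[OF that, of t]], of h 1] by (simp add: mult.commute)
    qed
    then have "((\<lambda>s. u (x, s)) has_real_derivative dir_deriv (0, 1) u (x, t)) (at t)"
      using dt[OF that, of t] unfolding has_field_derivative_def by simp
    then show ?thesis by (rule DERIV_imp_deriv)
  qed
  have p1: "partial i (\<lambda>y. u (y, t)) x = dir_deriv (axis i 1, 0) u (x, t)" if "x \<in> \<Omega>" for i x t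
    using dir_deriv_eq[OF slice_derivative(1)[OF diff[OF that]]] .
  have p2: "partial i (partial j (\<lambda>y. u (y, t))) x = dir_deriv (axis i 1, 0) (dir_deriv (axis j 1, 0) u) (x, t)"
    if "x \<in> \<Omega>" for i j x t
  proof -
    have "partial i (partial j (\<lambda>y. u (y, t))) x = partial i (\<lambda>y. dir_deriv (axis j 1, 0) u (y, t)) x"
      using p1 by (intro dir_deriv_cong[OF assms(1) that])
    then show ?thesis using dir_deriv_eq[OF slice_derivative(1)[OF diff2[OF that]]] by simp
  qed
  show ?thesis unfolding C21_on_def
  proof (intro conjI allI impI ballI)
    fix t :: real
    show "Ck_on 2 \<Omega> (\<lambda>x. u (x, t))" using Ck_on_slice[OF o u, of 2 t] unfolding slice .
  next
    fix x and t :: real assume "x \<in> \<Omega>"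
    then show "(\<lambda>s. u (x, s)) differentiable (at t)" using dt by (auto simp: differentiable_def)
  next
    show "continuous_on (\<Omega> \<times> {0<..}) u"
      using u[of 0] sub by (auto intro: continuous_on_subset)
    have "continuous_on (\<Omega> \<times> {0<..}) (dir_deriv (0, 1) u)"
      using c1 sub by (rule continuous_on_subset)
    then show "continuous_on (\<Omega> \<times> {0<..}) (\<lambda>(x, t). deriv (\<lambda>s. u (x, s)) t)"
      by (rule iffD1[OF continuous_on_cong, rotated -1]) (auto simp: deriv)
  next
    fix i
    have "continuous_on (\<Omega> \<times> {0<..}) (dir_deriv (axis i 1, 0) u)"
      using c1 sub by (rule continuous_on_subset)
    then show "continuous_on (\<Omega> \<times> {0<..}) (\<lambda>(x, t). partial i (\<lambda>y. u (y, t)) x)"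
      by (rule iffD1[OF continuous_on_cong, rotated -1]) (auto simp: p1)
  next
    fix i j
    have "continuous_on (\<Omega> \<times> {0<..}) (dir_deriv (axis i 1, 0) (dir_deriv (axis j 1, 0) u))"
      using c2 sub by (rule continuous_on_subset)
    then show "continuous_on (\<Omega> \<times> {0<..}) (\<lambda>(x, t). partial i (partial j (\<lambda>y. u (y, t))) x)"
      by (rule iffD1[OF continuous_on_cong, rotated -1]) (auto simp: p2)
  qed
qed

section \<open>Radial functions and separated solutions\<close>

lemma has_derivative_radial:
  fixes x :: "'a::real_inner"
  assumes "x \<noteq> 0" "(F has_real_derivative d) (at (norm x))"
  shows "((\<lambda>y. F (norm y)) has_derivative (\<lambda>v. d * (x \<bullet> v / norm x))) (at x)"
proof -
  have "(norm has_derivative (\<lambda>v. x \<bullet> v / norm x)) (at x)"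
    using has_derivative_norm[OF assms(1)] by (simp add: sgn_div_norm divide_inverse mult.commute inner_commute)
  from DERIV_compose_FDERIV[OF assms(2) this] show ?thesis by (simp add: mult.commute)
qed

text \<open>The algebra generated by the coordinates, \<open>1 / norm x\<close>, \<open>\<phi> (norm x)\<close>, \<open>\<phi>' (norm x)\<close> and
  \<open>exp (- l * t)\<close> is closed under differentiation because of the differential equation for \<open>\<phi>\<close>.\<close>

inductive_set separated_alg :: "(real \<Rightarrow> real) \<Rightarrow> (real \<Rightarrow> real) \<Rightarrow> real \<Rightarrow> ('a::real_inner \<times> real \<Rightarrow> real) set"
  for \<phi> \<phi>' :: "real \<Rightarrow> real" and l :: real where
  const: "(\<lambda>_. c) \<in> separated_alg \<phi> \<phi>' l"
| inner: "(\<lambda>p. fst p \<bullet> v) \<in> separated_alg \<phi> \<phi>' l"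
| inv_norm: "(\<lambda>p. 1 / norm (fst p)) \<in> separated_alg \<phi> \<phi>' l"
| profile: "(\<lambda>p. \<phi> (norm (fst p))) \<in> separated_alg \<phi> \<phi>' l"
| profile': "(\<lambda>p. \<phi>' (norm (fst p))) \<in> separated_alg \<phi> \<phi>' l"
| exp: "(\<lambda>p. exp (- l * snd p)) \<in> separated_alg \<phi> \<phi>' l"
| add: "f \<in> separated_alg \<phi> \<phi>' l \<Longrightarrow> g \<in> separated_alg \<phi> \<phi>' l \<Longrightarrow> (\<lambda>p. f p + g p) \<in> separated_alg \<phi> \<phi>' l"
| mult: "f \<in> separated_alg \<phi> \<phi>' l \<Longrightarrow> g \<in> separated_alg \<phi> \<phi>' l \<Longrightarrow> (\<lambda>p. f p * g p) \<in> separated_alg \<phi> \<phi>' l"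

text \<open>Formulas in the algebra are total, but differentiation is claimed only on the annulus.
  The differential equation enters in the case \<open>profile'\<close>, and \<open>0 \<le> a\<close>
  keeps the norm away from its singularity at the origin.\<close>

lemma separated_alg_derivative:
  fixes f :: "'a::real_inner \<times> real \<Rightarrow> real"
  assumes "0 \<le> a"
    and \<phi>: "\<And>r. a < r \<Longrightarrow> r < b \<Longrightarrow> (\<phi> has_real_derivative \<phi>' r) (at r)"
    and \<phi>': "\<And>r. a < r \<Longrightarrow> r < b \<Longrightarrow> (\<phi>' has_real_derivative - (m / r) * \<phi>' r - l * \<phi> r) (at r)"
    and f: "f \<in> separated_alg \<phi> \<phi>' l"
  shows "\<exists>D. (\<forall>p. a < norm (fst p) \<and> norm (fst p) < b \<longrightarrow> (f has_derivative D p) (at p)) \<and>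
    (\<forall>v. (\<lambda>p. D p v) \<in> separated_alg \<phi> \<phi>' l)"
proof -
  have radial: "\<exists>D. (\<forall>p. a < norm (fst p) \<and> norm (fst p) < b \<longrightarrow> ((\<lambda>p :: 'a \<times> real. F (norm (fst p))) has_derivative D p) (at p)) \<and>
    (\<forall>v. (\<lambda>p. D p v) \<in> separated_alg \<phi> \<phi>' l)"
    if F: "\<And>r. a < r \<Longrightarrow> r < b \<Longrightarrow> (F has_real_derivative F' r) (at r)"
      and F': "(\<lambda>p :: 'a \<times> real. F' (norm (fst p))) \<in> separated_alg \<phi> \<phi>' l" for F F' :: "real \<Rightarrow> real"
  proof (intro exI[of _ "\<lambda>p v. F' (norm (fst p)) * ((fst p \<bullet> fst v) * (1 / norm (fst p)))"] conjI allI impI)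
    fix p :: "'a \<times> real" assume p: "a < norm (fst p) \<and> norm (fst p) < b"
    then have "fst p \<noteq> 0" using assms(1) by auto
    from diff_chain_at[OF has_derivative_fst[OF has_derivative_ident] has_derivative_radial[OF this F]] p
    show "((\<lambda>p. F (norm (fst p))) has_derivative (\<lambda>v. F' (norm (fst p)) * ((fst p \<bullet> fst v) * (1 / norm (fst p))))) (at p)"
      by (simp add: o_def)
  next
    fix v :: "'a \<times> real"
    show "(\<lambda>p. F' (norm (fst p)) * ((fst p \<bullet> fst v) * (1 / norm (fst p)))) \<in> separated_alg \<phi> \<phi>' l"
      by (intro separated_alg.intros F')
  qed
  show ?thesis using f
  proof induction
  case (const c)
  show ?case
    by (rule exI[of _ "\<lambda>p v. 0"]) (auto intro: separated_alg.const)
next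
  case (inner v)
  show ?case
    by (rule exI[of _ "\<lambda>p h. fst h \<bullet> v"]) (auto intro!: derivative_eq_intros separated_alg.const)
next
  case inv_norm
  have "(\<lambda>p. (- 1) * ((1 / norm (fst p)) * (1 / norm (fst p)))) \<in> separated_alg \<phi> \<phi>' l"
    by (intro separated_alg.intros)
  then show ?case
    by (intro radial[where F = "\<lambda>r. 1 / r" and F' = "\<lambda>r. (- 1) * ((1 / r) * (1 / r))"])
       (use assms(1) in \<open>auto intro!: derivative_eq_intros\<close>)
next
  case profile
  show ?case by (rule radial[OF \<phi> separated_alg.profile'])
next
  case profile'
  have "(\<lambda>p. (- m) * ((1 / norm (fst p)) * \<phi>' (norm (fst p))) + (- l) * \<phi> (norm (fst p))) \<in> separated_alg \<phi> \<phi>' l"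
    by (intro separated_alg.intros)
  moreover have "(\<phi>' has_real_derivative (- m) * ((1 / r) * \<phi>' r) + (- l) * \<phi> r) (at r)" if "a < r" "r < b" for r
    using \<phi>'[OF that] by simp
  ultimately show ?case by (rule radial[rotated])
next
  case exp
  have "(\<lambda>p. - l * snd v * exp (- l * snd p)) \<in> separated_alg \<phi> \<phi>' l" for v :: "'a \<times> real"
    by (intro separated_alg.intros)
  then show ?case
    by (intro exI[of _ "\<lambda>p v. - l * snd v * exp (- l * snd p)"]) (auto intro!: derivative_eq_intros)
next
  case (add f g)
  then obtain D E where
    D: "\<And>p. a < norm (fst p) \<and> norm (fst p) < b \<Longrightarrow> (f has_derivative D p) (at p)" "\<And>v. (\<lambda>p. D p v) \<in> separated_alg \<phi> \<phi>' l"
    and E: "\<And>p. a < norm (fst p) \<and> norm (fst p) < b \<Longrightarrow> (g has_derivative E p) (at p)" "\<And>v. (\<lambda>p. E p v) \<in> separated_alg \<phi> \<phi>' l"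
    by metis
  show ?case
    by (intro exI[of _ "\<lambda>p v. D p v + E p v"] conjI allI impI has_derivative_add separated_alg.intros D E) auto
next
  case (mult f g)
  then obtain D E where
    D: "\<And>p. a < norm (fst p) \<and> norm (fst p) < b \<Longrightarrow> (f has_derivative D p) (at p)" "\<And>v. (\<lambda>p. D p v) \<in> separated_alg \<phi> \<phi>' l"
    and E: "\<And>p. a < norm (fst p) \<and> norm (fst p) < b \<Longrightarrow> (g has_derivative E p) (at p)" "\<And>v. (\<lambda>p. E p v) \<in> separated_alg \<phi> \<phi>' l"
    by metis
  show ?case
    by (intro exI[of _ "\<lambda>p v. f p * E p v + D p v * g p"] conjI allI impI has_derivative_mult separated_alg.intros D E mult.hyps) auto
  qed
qed

lemma open_annulus: "open {p :: 'a::real_normed_vector \<times> real. a < norm (fst p) \<and> norm (fst p) < b}"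
  by (intro open_Collect_conj open_Collect_less continuous_intros)

text \<open>With \<open>l = 0\<close> this also covers the harmonic part, whose exponential factor
  is then constantly 1.\<close>

lemma separated_Ck_on:
  fixes a b l m :: real and \<phi> \<phi>' :: "real \<Rightarrow> real"
  assumes "0 \<le> a"
    and \<phi>: "\<And>r. a < r \<Longrightarrow> r < b \<Longrightarrow> (\<phi> has_real_derivative \<phi>' r) (at r)"
    and \<phi>': "\<And>r. a < r \<Longrightarrow> r < b \<Longrightarrow> (\<phi>' has_real_derivative - (m / r) * \<phi>' r - l * \<phi> r) (at r)"
  shows "Ck_on k {p :: 'a::euclidean_space \<times> real. a < norm (fst p) \<and> norm (fst p) < b}
     (\<lambda>p. \<phi> (norm (fst p)) * exp (- l * snd p))"
proof (rule Ck_on_coinduct[OF _ _ open_annulus])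
  have D: "\<exists>D. (\<forall>p. a < norm (fst p) \<and> norm (fst p) < b \<longrightarrow> (f has_derivative D p) (at p)) \<and>
      (\<forall>v. (\<lambda>p. D p v) \<in> separated_alg \<phi> \<phi>' l)" if "f \<in> separated_alg \<phi> \<phi>' l" for f :: "'a \<times> real \<Rightarrow> real"
    by (rule separated_alg_derivative[where m = m]) (use assms that in auto)
  show "(\<lambda>p. \<phi> (norm (fst p)) * exp (- l * snd p)) \<in> separated_alg \<phi> \<phi>' l"
    by (intro separated_alg.intros)
  fix f :: "'a \<times> real \<Rightarrow> real" assume f: "f \<in> separated_alg \<phi> \<phi>' l"
  show "f differentiable (at p)" if "p \<in> {p. a < norm (fst p) \<and> norm (fst p) < b}" for p
    using D[OF f] that unfolding differentiable_def by blast
  fix v :: "'a \<times> real"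
  show "\<exists>g\<in>separated_alg \<phi> \<phi>' l. \<forall>p\<in>{p. a < norm (fst p) \<and> norm (fst p) < b}. dir_deriv v f p = g p"
  proof -
    obtain D' where D': "\<forall>p. a < norm (fst p) \<and> norm (fst p) < b \<longrightarrow> (f has_derivative D' p) (at p)"
      "(\<lambda>p. D' p v) \<in> separated_alg \<phi> \<phi>' l" using D[OF f] by blast
    show ?thesis
    proof (intro bexI[of _ "\<lambda>p. D' p v"] ballI D')
      fix p :: "'a \<times> real" assume "p \<in> {p. a < norm (fst p) \<and> norm (fst p) < b}"
      then show "dir_deriv v f p = D' p v" using D'(1) dir_deriv_eq[of f "D' p" p v] by blast
    qed
  qed
qed

lemma
  fixes x :: "real ^ 'n::finite" and F F' :: "real \<Rightarrow> real"
  assumes "0 \<le> a" "a < norm x" "norm x < b"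
    and F: "\<And>r. a < r \<Longrightarrow> r < b \<Longrightarrow> (F has_real_derivative F' r) (at r)"
  shows gradient_radial: "x \<bullet> gradient (\<lambda>y. F (norm y)) x = norm x * F' (norm x)"
    and laplacian_radial: "(F' has_real_derivative d) (at (norm x)) \<Longrightarrow>
      laplacian (\<lambda>y. F (norm y)) x = d + (real CARD('n) - 1) / norm x * F' (norm x)"
proof -
  let ?U = "{y :: real ^ 'n. a < norm y \<and> norm y < b}"
  have U: "open ?U" by (intro open_Collect_conj open_Collect_less continuous_intros)
  have x: "x \<in> ?U" "x \<noteq> 0" "norm x \<noteq> 0" using assms by auto
  have p1: "partial i (\<lambda>y. F (norm y)) y = F' (norm y) / norm y * (y \<bullet> axis i 1)" if "y \<in> ?U" for i y
  proof -
    have "y \<noteq> 0" using that assms(1) by auto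
    then have "partial i (\<lambda>y. F (norm y)) y = F' (norm y) * (y \<bullet> axis i 1 / norm y)"
      using that by (intro dir_deriv_eq has_derivative_radial F) auto
    then show ?thesis by simp
  qed
  have sq: "(\<Sum>i\<in>UNIV. x $ i * x $ i) = norm x * norm x"
    by (metis inner_vec_def inner_real_def power2_norm_eq_inner power2_eq_square)
  have "x \<bullet> gradient (\<lambda>y. F (norm y)) x = (\<Sum>i\<in>UNIV. F' (norm x) / norm x * (x $ i * x $ i))"
    unfolding gradient_def inner_vec_def using p1[OF x(1)] by (simp add: inner_axis mult_ac)
  also have "\<dots> = norm x * F' (norm x)"
    unfolding sum_distrib_left[symmetric] sq using x(3) by simp
  finally show "x \<bullet> gradient (\<lambda>y. F (norm y)) x = norm x * F' (norm x)" .
  assume d: "(F' has_real_derivative d) (at (norm x))"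
  \<comment> \<open>The gradient of a radial function is \<open>F' r / r\<close> times the position
    vector; \<open>g\<close> is the derivative of that coefficient.\<close>
  define g where "g = (d * norm x - F' (norm x)) / (norm x * norm x)"
  have G: "((\<lambda>r. F' r / r) has_real_derivative g) (at (norm x))"
    unfolding g_def using d x(3) by (auto intro!: derivative_eq_intros)
  have p2: "partial i (partial i (\<lambda>y. F (norm y))) x = g / norm x * (x $ i * x $ i) + F' (norm x) / norm x" for i
  proof -
    have "partial i (partial i (\<lambda>y. F (norm y))) x = partial i (\<lambda>y. F' (norm y) / norm y * (y \<bullet> axis i 1)) x"
      using p1 by (intro dir_deriv_cong[OF U x(1)])
    also have "\<dots> = F' (norm x) / norm x * (axis i 1 \<bullet> axis i (1::real)) + g * (x \<bullet> axis i 1 / norm x) * (x \<bullet> axis i 1)"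
      by (intro dir_deriv_eq has_derivative_mult has_derivative_radial[OF x(2) G]) (auto intro!: derivative_eq_intros)
    finally show ?thesis by (simp add: inner_axis)
  qed
  have "laplacian (\<lambda>y. F (norm y)) x = g / norm x * (norm x * norm x) + real CARD('n) * (F' (norm x) / norm x)"
    unfolding laplacian_def p2 sum.distrib sum_distrib_left[symmetric] sq by simp
  also have "\<dots> = d + (real CARD('n) - 1) / norm x * F' (norm x)"
    unfolding g_def using x(3) by (simp add: field_simps)
  finally show "laplacian (\<lambda>y. F (norm y)) x = d + (real CARD('n) - 1) / norm x * F' (norm x)" .
qed

subsection \<open>Comparison principle\<close>

lemma dir_deriv_line:
  assumes "f differentiable (at (x + s *\<^sub>R v))"
  shows "((\<lambda>s. f (x + s *\<^sub>R v)) has_real_derivative dir_deriv v f (x + s *\<^sub>R v)) (at s)"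
proof -
  let ?D = "frechet_derivative f (at (x + s *\<^sub>R v))"
  have D: "(f has_derivative ?D) (at (x + s *\<^sub>R v))" using assms frechet_derivative_works by blast
  have "((\<lambda>s. x + s *\<^sub>R v) has_derivative (\<lambda>h. h *\<^sub>R v)) (at s)" by (auto intro!: derivative_eq_intros)
  from diff_chain_at[OF this D]
  have *: "((\<lambda>s. f (x + s *\<^sub>R v)) has_derivative (\<lambda>h. ?D (h *\<^sub>R v))) (at s)" by (simp add: o_def)
  have "(\<lambda>h. ?D (h *\<^sub>R v)) = (*) (?D v)"
  proof
    show "?D (h *\<^sub>R v) = ?D v * h" for h
      using linear_cmul[OF has_derivative_linear[OF D], of h v] by (simp add: mult.commute)
  qed
  then show ?thesis using * unfolding has_field_derivative_def dir_deriv_def by simp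
qed

text \<open>Weak maximum principle. Subtracting \<open>\<epsilon> * t\<close> from
  \<open>v - u\<close> makes the contradiction strict: at a positive maximum, \<open>v - u\<close>
  has time derivative at least \<open>\<epsilon>\<close> but nonpositive Laplacian.\<close>

lemma heat_comparison:
  fixes \<Omega> :: "(real ^ 'n::finite) set"
  assumes "open \<Omega>" "bounded \<Omega>"
    and cont: "continuous_on (closure \<Omega> \<times> {0..}) u" "continuous_on (closure \<Omega> \<times> {0..}) v"
    and C21: "C21_on \<Omega> u" "C21_on \<Omega> v"
    and heat: "\<And>x t. x \<in> \<Omega> \<Longrightarrow> 0 < t \<Longrightarrow> deriv (\<lambda>s. u (x, s)) t = laplacian (\<lambda>y. u (y, t)) x"
      "\<And>x t. x \<in> \<Omega> \<Longrightarrow> 0 < t \<Longrightarrow> deriv (\<lambda>s. v (x, s)) t = laplacian (\<lambda>y. v (y, t)) x"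
    and initial: "\<And>x. x \<in> \<Omega> \<Longrightarrow> v (x, 0) \<le> u (x, 0)"
    and boundary: "\<And>x t. x \<in> closure \<Omega> - \<Omega> \<Longrightarrow> 0 \<le> t \<Longrightarrow> v (x, t) \<le> u (x, t)"
    and x: "x \<in> closure \<Omega>" and t: "0 \<le> t"
  shows "v (x, t) \<le> u (x, t)"
proof (rule ccontr)
  assume "\<not> ?thesis"
  then have pos: "0 < v (x, t) - u (x, t)" by simp
  \<comment> \<open>The divisor \<open>t + 1\<close> leaves the penalised difference positive at the
    supposed counterexample \<open>(x, t)\<close>.\<close>
  define \<epsilon> where "\<epsilon> = (v (x, t) - u (x, t)) / (t + 1)"
  have \<epsilon>: "0 < \<epsilon>" using pos t by (simp add: \<epsilon>_def)
  define g where "g = (\<lambda>p. v p - u p - \<epsilon> * snd p)"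
  have gpos: "0 < g (x, t)" using pos t by (simp add: g_def \<epsilon>_def field_simps)
  let ?K = "closure \<Omega> \<times> {0..t}"
  have "compact ?K" using assms(2) by (intro compact_Times) (auto simp: compact_closure)
  moreover have "continuous_on ?K g" unfolding g_def
    by (intro continuous_intros cont[THEN continuous_on_subset]) auto
  moreover have "?K \<noteq> {}" using x t by auto
  ultimately obtain p where p: "p \<in> ?K" "\<And>q. q \<in> ?K \<Longrightarrow> g q \<le> g p"
    using continuous_attains_sup[of ?K g] by blast
  obtain x1 t1 where pe: "p = (x1, t1)" by (cases p)
  have t1: "0 \<le> t1" "t1 \<le> t" and x1c: "x1 \<in> closure \<Omega>" using p(1) by (auto simp: pe)
  have "0 < g (x1, t1)" using p(2)[of "(x, t)"] gpos x t by (auto simp: pe)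
  moreover have "0 \<le> \<epsilon> * t1" using \<epsilon> t1 by simp
  ultimately have w: "u (x1, t1) < v (x1, t1)" unfolding g_def snd_conv by linarith
  then have x1: "x1 \<in> \<Omega>" using boundary[of x1 t1] x1c t1 by fastforce
  have t1': "0 < t1" using initial[OF x1] w t1 by (cases "t1 = 0") auto
  \<comment> \<open>The maximum may sit at the final time \<open>t\<close>, so it is compared with
    earlier times only, which yields an inequality.\<close>
  have "0 \<le> deriv (\<lambda>s. v (x1, s)) t1 - deriv (\<lambda>s. u (x1, s)) t1 - \<epsilon>" (is "0 \<le> ?d")
  proof (rule ccontr)
    assume neg: "\<not> 0 \<le> ?d"
    have "((\<lambda>s. v (x1, s)) has_real_derivative deriv (\<lambda>s. v (x1, s)) t1) (at t1)"
      "((\<lambda>s. u (x1, s)) has_real_derivative deriv (\<lambda>s. u (x1, s)) t1) (at t1)"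
      using C21 x1 t1' unfolding C21_on_def DERIV_deriv_iff_real_differentiable by blast+
    then have "((\<lambda>s. g (x1, s)) has_real_derivative ?d) (at t1)"
      unfolding g_def by (auto intro!: derivative_eq_intros)
    then obtain \<delta> where \<delta>: "0 < \<delta>" "\<And>h. 0 < h \<Longrightarrow> h < \<delta> \<Longrightarrow> g (x1, t1) < g (x1, t1 - h)"
      using DERIV_neg_dec_left[of "\<lambda>s. g (x1, s)" ?d t1] neg by auto
    define h where "h = min (\<delta> / 2) t1"
    have "0 < h" "h < \<delta>" "h \<le> t1" using \<delta>(1) t1' by (auto simp: h_def)
    then show False using \<delta>(2)[of h] p(2)[of "(x1, t1 - h)"] x1c t1 by (auto simp: pe)
  qed
  \<comment> \<open>On a coordinate line through the maximum, a positive second derivative would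
    make it a strict local minimum.\<close>
  moreover have "partial i (partial i (\<lambda>y. v (y, t1))) x1 - partial i (partial i (\<lambda>y. u (y, t1))) x1 \<le> 0" for i
  proof (rule ccontr)
    let ?u = "\<lambda>y. u (y, t1)" and ?v = "\<lambda>y. v (y, t1)" and ?e = "axis i 1 :: real ^ 'n"
    assume "\<not> ?thesis"
    then have d: "0 < partial i (partial i ?v) x1 - partial i (partial i ?u) x1" by simp
    obtain \<delta> where \<delta>: "0 < \<delta>" "ball x1 \<delta> \<subseteq> \<Omega>" using assms(1) x1 openE by blast
    have in\<Omega>: "x1 + s *\<^sub>R ?e \<in> \<Omega>" if "\<bar>s\<bar> < \<delta>" for s
      using \<delta>(2) that by (auto simp: dist_norm subset_iff)
    have "Ck_on 2 \<Omega> ?u" "Ck_on 2 \<Omega> ?v" using C21 t1' unfolding C21_on_def by blast+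
    then have diff: "\<And>y. y \<in> \<Omega> \<Longrightarrow> ?u differentiable (at y)" "\<And>y. y \<in> \<Omega> \<Longrightarrow> ?v differentiable (at y)"
      "\<And>y. y \<in> \<Omega> \<Longrightarrow> partial i ?u differentiable (at y)" "\<And>y. y \<in> \<Omega> \<Longrightarrow> partial i ?v differentiable (at y)"
      unfolding numeral_2_eq_2 Ck_on.simps by blast+
    let ?k = "\<lambda>s. ?v (x1 + s *\<^sub>R ?e) - ?u (x1 + s *\<^sub>R ?e)"
    let ?k' = "\<lambda>s. partial i ?v (x1 + s *\<^sub>R ?e) - partial i ?u (x1 + s *\<^sub>R ?e)"
    have k: "(?k has_real_derivative ?k' s) (at s)" if "\<bar>s\<bar> < \<delta>" for s
      by (intro DERIV_diff dir_deriv_line diff in\<Omega> that)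
    have k2: "(?k' has_real_derivative partial i (partial i ?v) (x1 + 0 *\<^sub>R ?e) - partial i (partial i ?u) (x1 + 0 *\<^sub>R ?e)) (at 0)"
      by (intro DERIV_diff dir_deriv_line diff in\<Omega>) (simp_all add: \<delta>(1))
    have max: "?k s \<le> ?k 0" if "\<bar>s\<bar> < \<delta>" for s
    proof -
      have "(x1 + s *\<^sub>R ?e, t1) \<in> ?K" using in\<Omega>[OF that] closure_subset t1 by auto
      then show ?thesis using p(2) by (force simp: pe g_def)
    qed
    have "?k' 0 = 0"
      using DERIV_local_max[OF k[of 0] \<delta>(1)] max \<delta>(1) by auto
    with \<delta>(1) k k2 d obtain \<eta> where \<eta>: "0 < \<eta>" "\<And>s. 0 < \<bar>s\<bar> \<Longrightarrow> \<bar>s\<bar> < \<eta> \<Longrightarrow> ?k 0 < ?k s"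
      using strict_local_min_second_derivative[of \<delta> ?k ?k' "partial i (partial i ?v) x1 - partial i (partial i ?u) x1"] by auto
    define s where "s = min \<delta> \<eta> / 2"
    have "0 < \<bar>s\<bar>" "\<bar>s\<bar> < \<eta>" "\<bar>s\<bar> < \<delta>" using \<delta>(1) \<eta>(1) by (auto simp: s_def)
    then show False using \<eta>(2)[of s] max[of s] by linarith
  qed
  then have "laplacian (\<lambda>y. v (y, t1)) x1 - laplacian (\<lambda>y. u (y, t1)) x1 \<le> 0"
    unfolding laplacian_def sum_subtractf[symmetric] by (intro sum_nonpos) auto
  ultimately show False using heat[OF x1 t1'] \<epsilon> by simp
qed

subsection \<open>Radial eigenfunctions and harmonic functions\<close>

text \<open>Liouville's substitution \<open>f r = r powr (- m/2) * y (r - R)\<close> turns \<open>f'' + (m/r) f' + l f = 0\<close> into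
  \<open>y'' = (q - l) y\<close>, where \<open>q\<close> is of order \<open>1/R\<^sup>2\<close>; this is where \<open>R\<close> has to be large.\<close>

lemma radial_eigenfunctions:
  fixes m :: real
  shows "\<exists>R0. \<forall>R. 1 < R \<and> R0 \<le> R \<longrightarrow> (\<exists>l1 l2 f1 d1 f2 d2. 0 < l1 \<and> l1 < l2 \<and>
    (\<forall>r. R - 1/2 < r \<and> r < R + 3/2 \<longrightarrow>
      (f1 has_real_derivative d1 r) (at r) \<and> (d1 has_real_derivative - (m / r) * d1 r - l1 * f1 r) (at r) \<and>
      (f2 has_real_derivative d2 r) (at r) \<and> (d2 has_real_derivative - (m / r) * d2 r - l2 * f2 r) (at r)) \<and>
    f1 R = 0 \<and> f2 R = 0 \<and> f1 (R + 1) = 0 \<and> f2 (R + 1) = 0 \<and> 0 < d1 R \<and> d2 R = d1 R \<and>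
    (\<forall>r\<in>{R..R+1}. f2 r \<le> f1 r) \<and> (\<exists>r\<in>{R<..<R+1}. f2 r < f1 r))"
\<comment> \<open>The Liouville potential is \<open>c / r\<^sup>2\<close> with
  \<open>c = m/2 * (m/2 - 1)\<close>. As \<open>R > 1\<close> gives
  \<open>(R + s)\<^sup>2 \<ge> R\<close>, this choice forces it below
  \<open>exp (- 103) / 100\<close> on the ring.\<close>
proof (rule exI[of _ "\<bar>m/2 * (m/2 - 1)\<bar> * (100 * exp 103)"], intro allI impI)
  define c where "c = m/2 * (m/2 - 1)"
  fix R :: real assume "1 < R \<and> \<bar>m/2 * (m/2 - 1)\<bar> * (100 * exp 103) \<le> R"
  then have R: "1 < R \<and> \<bar>c\<bar> * (100 * exp 103) \<le> R" by (simp only: c_def)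
  let ?I = "{-1/2..3/2::real}"
  define q where "q = (\<lambda>s. c / (R + s)\<^sup>2)"
  have "continuous_on ?I q" unfolding q_def using R by (intro continuous_intros) auto
  moreover have "\<bar>q s\<bar> \<le> exp (- 103) / 100" if "s \<in> {0..1}" for s
  proof -
    have "R * 1 \<le> (R + s) * (R + s)" using R that by (intro mult_mono) auto
    then have "\<bar>c\<bar> * (100 * exp 103) \<le> (R + s)\<^sup>2" using R by (simp add: power2_eq_square)
    moreover have "0 < (R + s)\<^sup>2" using R that by simp
    ultimately show ?thesis unfolding q_def by (simp add: exp_minus field_simps)
  qed
  ultimately obtain l1 l2 y1 z1 y2 z2 where l: "0 < l1" "l1 < l2"
    and yz1: "\<forall>s\<in>?I. (y1 has_real_derivative z1 s) (at s within ?I) \<and>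
      (z1 has_real_derivative (q s - l1) * y1 s) (at s within ?I)"
    and yz2: "\<forall>s\<in>?I. (y2 has_real_derivative z2 s) (at s within ?I) \<and>
      (z2 has_real_derivative (q s - l2) * y2 s) (at s within ?I)"
    and init: "y1 0 = 0" "y2 0 = 0" "z1 0 = 1" "z2 0 = 1" "y1 1 = 0" "y2 1 = 0"
    and le: "\<forall>s\<in>{0..1}. y2 s \<le> y1 s" and lt: "\<exists>s\<in>{0<..<1}. y2 s < y1 s"
    by (rule two_eigenfunctions)
  define P where "P = (\<lambda>r::real. r powr (- m/2))"
  define F where "F = (\<lambda>y r. P r * y (r - R))"
  \<comment> \<open>At \<open>r = R\<close> the value is \<open>P R\<close> for both profiles, as
    \<open>y\<close> vanishes and \<open>z\<close> is 1 there; this is the normalisation of equal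
    slopes.\<close>
  define D where "D = (\<lambda>y z r. P r * (z (r - R) - m/2 / r * y (r - R)))"
  have P: "(P has_real_derivative - (m/2) / r * P r) (at r)" "0 < P r" if "0 < r" for r
    using that by (auto simp: P_def powr_diff intro!: derivative_eq_intros)
  have shift: "((\<lambda>r. f (r - R)) has_real_derivative d) (at r)"
    if "(f has_real_derivative d) (at (r - R) within ?I)" "R - 1/2 < r" "r < R + 3/2" for f d r
  proof -
    have "(f has_real_derivative d) (at (r + (- R)))" using that by (simp add: at_within_Icc_at)
    then show ?thesis unfolding DERIV_shift by simp
  qed
  have FD: "(F y has_real_derivative D y z r) (at r)"
    "(D y z has_real_derivative - (m / r) * D y z r - l * F y r) (at r)"
    if yz: "\<forall>s\<in>?I. (y has_real_derivative z s) (at s within ?I) \<and>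
        (z has_real_derivative (q s - l) * y s) (at s within ?I)"
      and r: "R - 1/2 < r" "r < R + 3/2" for y z l r
  proof -
    have r0: "0 < r" using r R by simp
    have yr: "((\<lambda>r. y (r - R)) has_real_derivative z (r - R)) (at r)"
      using r yz by (intro shift) auto
    have zr: "((\<lambda>r. z (r - R)) has_real_derivative (q (r - R) - l) * y (r - R)) (at r)"
      using r yz by (intro shift) auto
    show "(F y has_real_derivative D y z r) (at r)"
      unfolding F_def D_def by (auto intro!: derivative_eq_intros P[OF r0] yr simp: algebra_simps)
    have inv: "((\<lambda>r. m/2 / r) has_real_derivative - (m/2) / r\<^sup>2) (at r)"
      using r0 by (auto intro!: derivative_eq_intros simp: power2_eq_square)
    show "(D y z has_real_derivative - (m / r) * D y z r - l * F y r) (at r)"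
      unfolding D_def
      by (rule DERIV_cong[OF DERIV_mult[OF P(1)[OF r0] DERIV_diff[OF zr DERIV_mult[OF inv yr]]]])
         (use r0 in \<open>simp add: F_def q_def c_def field_simps power2_eq_square\<close>)
  qed
  have R0: "0 < R" using R by simp
  show "\<exists>l1 l2 f1 d1 f2 d2. 0 < l1 \<and> l1 < l2 \<and>
    (\<forall>r. R - 1/2 < r \<and> r < R + 3/2 \<longrightarrow>
      (f1 has_real_derivative d1 r) (at r) \<and> (d1 has_real_derivative - (m / r) * d1 r - l1 * f1 r) (at r) \<and>
      (f2 has_real_derivative d2 r) (at r) \<and> (d2 has_real_derivative - (m / r) * d2 r - l2 * f2 r) (at r)) \<and>
    f1 R = 0 \<and> f2 R = 0 \<and> f1 (R + 1) = 0 \<and> f2 (R + 1) = 0 \<and> 0 < d1 R \<and> d2 R = d1 R \<and>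
    (\<forall>r\<in>{R..R+1}. f2 r \<le> f1 r) \<and> (\<exists>r\<in>{R<..<R+1}. f2 r < f1 r)"
  proof (rule exI[of _ l1], rule exI[of _ l2], rule exI[of _ "F y1"], rule exI[of _ "D y1 z1"],
      rule exI[of _ "F y2"], rule exI[of _ "D y2 z2"], intro conjI ballI allI impI)
    fix r assume "R - 1/2 < r \<and> r < R + 3/2"
    then show "(F y1 has_real_derivative D y1 z1 r) (at r)" "(F y2 has_real_derivative D y2 z2 r) (at r)"
      "(D y1 z1 has_real_derivative - (m / r) * D y1 z1 r - l1 * F y1 r) (at r)"
      "(D y2 z2 has_real_derivative - (m / r) * D y2 z2 r - l2 * F y2 r) (at r)"
      using FD[OF yz1, of r] FD[OF yz2, of r] by auto
  next
    fix r assume r: "r \<in> {R..R+1}"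
    then show "F y2 r \<le> F y1 r"
      using bspec[OF le, of "r - R"] P(2)[of r] R0 by (auto simp: F_def intro!: mult_left_mono)
  next
    obtain s where "s \<in> {0<..<1}" "y2 s < y1 s" using lt by blast
    then show "\<exists>r\<in>{R<..<R+1}. F y2 r < F y1 r"
      using P(2)[of "R + s"] R0 by (intro bexI[of _ "R + s"]) (auto simp: F_def)
  qed (use l init P(2)[OF R0] in \<open>auto simp: F_def D_def\<close>)
qed

text \<open>Radial harmonicity means that \<open>r powr m * h' r\<close> is constant, so
  \<open>h'\<close> is a negative multiple of \<open>r powr (- m)\<close>, whose antiderivative is
  logarithmic exactly when \<open>m = 1\<close>. The summand \<open>0 * h r\<close> matches the
  eigenvalue equation with eigenvalue 0.\<close>

lemma radial_harmonic:
  fixes m R :: real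
  assumes "0 < R"
  obtains h h' where "\<And>r. 0 < r \<Longrightarrow> (h has_real_derivative h' r) (at r)"
    "\<And>r. 0 < r \<Longrightarrow> (h' has_real_derivative - (m / r) * h' r - 0 * h r) (at r)"
    "h R = 1" "h (R + 1) = 0" "\<And>r. 0 < r \<Longrightarrow> h' r < 0"
proof -
  define G where "G = (\<lambda>r. if m = 1 then ln r else r powr (1 - m) / (1 - m))"
  have G: "(G has_real_derivative r powr (- m)) (at r)" if "0 < r" for r
    using that by (cases "m = 1") (auto simp: G_def powr_minus inverse_eq_divide intro!: derivative_eq_intros)
  have "G R < G (R + 1)"
    using assms by (intro DERIV_pos_imp_increasing[of R "R + 1" G]) (auto intro!: exI G)
  then have k: "0 < G (R + 1) - G R" (is "0 < ?k") by simp
  show ?thesis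
  proof (rule that[of "\<lambda>r. 1 - (G r - G R) / ?k" "\<lambda>r. - (r powr (- m)) / ?k"])
    fix r :: real assume r: "0 < r"
    show "((\<lambda>r. 1 - (G r - G R) / ?k) has_real_derivative - (r powr (- m)) / ?k) (at r)"
      using k by (auto intro!: derivative_eq_intros G[OF r])
    have "((\<lambda>r. r powr (- m)) has_real_derivative - m * (r powr (- m) / r)) (at r)"
      using r by (auto intro!: derivative_eq_intros simp: powr_diff)
    then have "((\<lambda>r. - (r powr (- m)) / ?k) has_real_derivative - (- m * (r powr (- m) / r)) / ?k) (at r)"
      by (intro DERIV_cdivide DERIV_minus)
    then show "((\<lambda>r. - (r powr (- m)) / ?k) has_real_derivative
      - (m / r) * (- (r powr (- m)) / ?k) - 0 * (1 - (G r - G R) / ?k)) (at r)" by simp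
  qed (use k in \<open>auto simp: divide_neg_pos\<close>)
qed

subsection \<open>Failure of convexity along level curves\<close>

text \<open>The differential equation removes the second radial derivative, so the second derivative
  along a line involves only \<open>f\<close> and \<open>d\<close>. It is taken at the centre of the
  segment, where the second-derivative test is applied.\<close>

lemma separated_line_derivatives:
  fixes f d :: "real \<Rightarrow> real"
  assumes f: "\<And>r. a < r \<Longrightarrow> r < b \<Longrightarrow> (f has_real_derivative d r) (at r)"
    and d: "\<And>r. a < r \<Longrightarrow> r < b \<Longrightarrow> (d has_real_derivative - (m / r) * d r - l * f r) (at r)"
  shows "a < r + s * \<alpha> \<Longrightarrow> r + s * \<alpha> < b \<Longrightarrow>
      ((\<lambda>s. f (r + s * \<alpha>) * exp (- l * (t + s * \<beta>))) has_real_derivative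
       (\<alpha> * d (r + s * \<alpha>) - l * \<beta> * f (r + s * \<alpha>)) * exp (- l * (t + s * \<beta>))) (at s)"
    and "a < r \<Longrightarrow> r < b \<Longrightarrow>
      ((\<lambda>s. (\<alpha> * d (r + s * \<alpha>) - l * \<beta> * f (r + s * \<alpha>)) * exp (- l * (t + s * \<beta>))) has_real_derivative
       (\<alpha>\<^sup>2 * (- (m / r) * d r - l * f r) - 2 * l * \<alpha> * \<beta> * d r + l\<^sup>2 * \<beta>\<^sup>2 * f r) * exp (- l * t)) (at 0)"
proof -
  have lin: "((\<lambda>s. r + s * \<alpha>) has_real_derivative \<alpha>) (at s)" for s
    by (auto intro!: derivative_eq_intros)
  have fl: "((\<lambda>s. f (r + s * \<alpha>)) has_real_derivative d (r + s * \<alpha>) * \<alpha>) (at s)"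
    if "a < r + s * \<alpha>" "r + s * \<alpha> < b" for s
    using DERIV_chain2[OF f lin] that by blast
  have dl: "((\<lambda>s. d (r + s * \<alpha>)) has_real_derivative (- (m / (r + s * \<alpha>)) * d (r + s * \<alpha>) - l * f (r + s * \<alpha>)) * \<alpha>) (at s)"
    if "a < r + s * \<alpha>" "r + s * \<alpha> < b" for s
    using DERIV_chain2[OF d lin] that by blast
  have el: "((\<lambda>s. exp (- l * (t + s * \<beta>))) has_real_derivative - l * \<beta> * exp (- l * (t + s * \<beta>))) (at s)" for s
    by (auto intro!: derivative_eq_intros)
  show "((\<lambda>s. f (r + s * \<alpha>) * exp (- l * (t + s * \<beta>))) has_real_derivative
       (\<alpha> * d (r + s * \<alpha>) - l * \<beta> * f (r + s * \<alpha>)) * exp (- l * (t + s * \<beta>))) (at s)"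
    if "a < r + s * \<alpha>" "r + s * \<alpha> < b"
    using DERIV_mult[OF fl[OF that] el] by (simp add: algebra_simps)
  assume r: "a < r" "r < b"
  have *: "((\<lambda>s. \<alpha> * d (r + s * \<alpha>) - l * \<beta> * f (r + s * \<alpha>)) has_real_derivative
      \<alpha> * ((- (m / r) * d r - l * f r) * \<alpha>) - l * \<beta> * (d r * \<alpha>)) (at 0)"
    using fl[of 0] dl[of 0] r by (intro DERIV_diff DERIV_cmult) auto
  show "((\<lambda>s. (\<alpha> * d (r + s * \<alpha>) - l * \<beta> * f (r + s * \<alpha>)) * exp (- l * (t + s * \<beta>))) has_real_derivative
       (\<alpha>\<^sup>2 * (- (m / r) * d r - l * f r) - 2 * l * \<alpha> * \<beta> * d r + l\<^sup>2 * \<beta>\<^sup>2 * f r) * exp (- l * t)) (at 0)"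
    using DERIV_mult[OF * el[of 0]]
    by (rule DERIV_cong) (simp add: algebra_simps power2_eq_square)
qed

text \<open>\<open>m\<close> stands for the dimension minus one. The smallness of
  \<open>\<epsilon>\<close> is expressed by \<open>decr\<close>, radial monotonicity at all times;
  \<open>le\<close> and \<open>lt\<close> are the sign conditions on the initial Laplacian.\<close>

locale separated_profile =
  fixes R m \<epsilon> l1 l2 :: real and h h' f1 d1 f2 d2 :: "real \<Rightarrow> real"
  assumes R: "1 < R" and l: "0 < l1" "l1 < l2" and \<epsilon>: "0 < \<epsilon>"
    and h: "\<And>r. R - 1/2 < r \<Longrightarrow> r < R + 3/2 \<Longrightarrow> (h has_real_derivative h' r) (at r)"
      "\<And>r. R - 1/2 < r \<Longrightarrow> r < R + 3/2 \<Longrightarrow> (h' has_real_derivative - (m / r) * h' r - 0 * h r) (at r)"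
    and f1: "\<And>r. R - 1/2 < r \<Longrightarrow> r < R + 3/2 \<Longrightarrow> (f1 has_real_derivative d1 r) (at r)"
      "\<And>r. R - 1/2 < r \<Longrightarrow> r < R + 3/2 \<Longrightarrow> (d1 has_real_derivative - (m / r) * d1 r - l1 * f1 r) (at r)"
    and f2: "\<And>r. R - 1/2 < r \<Longrightarrow> r < R + 3/2 \<Longrightarrow> (f2 has_real_derivative d2 r) (at r)"
      "\<And>r. R - 1/2 < r \<Longrightarrow> r < R + 3/2 \<Longrightarrow> (d2 has_real_derivative - (m / r) * d2 r - l2 * f2 r) (at r)"
    and bdry: "h R = 1" "h (R + 1) = 0" "f1 R = 0" "f2 R = 0" "f1 (R + 1) = 0" "f2 (R + 1) = 0"
    and slope: "0 < d1 R" "d2 R = d1 R"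
    and le: "\<And>r. r \<in> {R..R+1} \<Longrightarrow> f2 r \<le> f1 r" and lt: "\<exists>r\<in>{R<..<R+1}. f2 r < f1 r"
    and decr: "\<And>r t. r \<in> {R..R+1} \<Longrightarrow> 0 \<le> t \<Longrightarrow>
      h' r - \<epsilon> / l1 * (d1 r * exp (- l1 * t)) + \<epsilon> / l2 * (d2 r * exp (- l2 * t)) < 0"
begin

definition U :: "real \<Rightarrow> real \<Rightarrow> real" where
  "U r t = h r - \<epsilon> / l1 * (f1 r * exp (- l1 * t)) + \<epsilon> / l2 * (f2 r * exp (- l2 * t))"

definition Ur :: "real \<Rightarrow> real \<Rightarrow> real" where
  "Ur r t = h' r - \<epsilon> / l1 * (d1 r * exp (- l1 * t)) + \<epsilon> / l2 * (d2 r * exp (- l2 * t))"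

text \<open>The divisors \<open>l1\<close> and \<open>l2\<close> in \<open>U\<close> are there to
  cancel here: at \<open>t = 0\<close> this is \<open>\<epsilon> * (f1 r - f2 r)\<close>, whose
  first-order term at \<open>R\<close> vanishes by the equal slopes.\<close>

definition Ut :: "real \<Rightarrow> real \<Rightarrow> real" where
  "Ut r t = \<epsilon> * (f1 r * exp (- l1 * t)) - \<epsilon> * (f2 r * exp (- l2 * t))"

text \<open>The second derivative of \<open>U\<close> along the direction \<open>(Ut, - Ur)\<close> tangent to its level curve.\<close>

definition Q :: "real \<Rightarrow> real \<Rightarrow> real" where
  "Q r t = (Ut r t)\<^sup>2 * (- (m / r) * h' r)
    - \<epsilon> / l1 * (((Ut r t)\<^sup>2 * (- (m / r) * d1 r - l1 * f1 r) + 2 * l1 * Ut r t * Ur r t * d1 r + l1\<^sup>2 * (Ur r t)\<^sup>2 * f1 r) * exp (- l1 * t))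
    + \<epsilon> / l2 * (((Ut r t)\<^sup>2 * (- (m / r) * d2 r - l2 * f2 r) + 2 * l2 * Ut r t * Ur r t * d2 r + l2\<^sup>2 * (Ur r t)\<^sup>2 * f2 r) * exp (- l2 * t))"

lemma in_range: "R - 1/2 < r" "r < R + 3/2" if "r \<in> {R..R+1}" for r
  using that by auto

lemma U_bdry: "U R t = 1" "U (R + 1) t = 0"
  by (simp_all add: U_def bdry)

lemma Ur_neg: "r \<in> {R..R+1} \<Longrightarrow> 0 \<le> t \<Longrightarrow> Ur r t < 0"
  unfolding Ur_def by (rule decr)

lemma U_deriv_r: "((\<lambda>r. U r t) has_real_derivative Ur r t) (at r)" if "R - 1/2 < r" "r < R + 3/2"
  unfolding U_def Ur_def by (intro DERIV_add DERIV_diff DERIV_cmult DERIV_cmult_right h f1 f2 that)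

text \<open>The radial heat equation, solved for the second radial derivative: the radial Laplacian
  multiplies each summand by minus its eigenvalue, and so does the time derivative.\<close>

lemma Ur_deriv_r: "((\<lambda>r. Ur r t) has_real_derivative Ut r t - m / r * Ur r t) (at r)"
  if "R - 1/2 < r" "r < R + 3/2"
proof -
  have "((\<lambda>r. Ur r t) has_real_derivative (- (m / r) * h' r - 0 * h r)
    - \<epsilon> / l1 * ((- (m / r) * d1 r - l1 * f1 r) * exp (- l1 * t)) + \<epsilon> / l2 * ((- (m / r) * d2 r - l2 * f2 r) * exp (- l2 * t))) (at r)"
    unfolding Ur_def by (intro DERIV_add DERIV_diff DERIV_cmult DERIV_cmult_right h f1 f2 that)
  then show ?thesis
    by (rule DERIV_cong) (use l R that in \<open>simp add: Ut_def Ur_def field_simps\<close>)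
qed

lemma U_deriv_t: "((\<lambda>t. U r t) has_real_derivative Ut r t) (at t)"
  unfolding U_def Ut_def using l by (auto intro!: derivative_eq_intros)

lemma U_antimono: "U s t \<le> U r t" if "R \<le> r" "r \<le> s" "s \<le> R + 1" "0 \<le> t"
proof (rule DERIV_nonpos_imp_nonincreasing[where f = "\<lambda>r. U r t", OF that(2)])
  fix x assume "r \<le> x" "x \<le> s"
  then have "x \<in> {R..R+1}" using that by auto
  then show "\<exists>y. ((\<lambda>r. U r t) has_real_derivative y) (at x) \<and> y \<le> 0"
    using U_deriv_r[OF in_range] Ur_neg[OF _ that(4)] less_imp_le by blast
qed

lemma Q_pos_initial: "\<exists>r\<in>{R<..<R+1}. 0 < Q r 0"
proof -
  have rng: "R - 1/2 < R" "R < R + 3/2" by auto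
  have cont: "isCont h' R" "isCont d1 R" "isCont d2 R" "isCont f1 R" "isCont f2 R"
    by (rule DERIV_isCont[OF h(2)[OF rng]] DERIV_isCont[OF f1(2)[OF rng]] DERIV_isCont[OF f2(2)[OF rng]]
      DERIV_isCont[OF f1(1)[OF rng]] DERIV_isCont[OF f2(1)[OF rng]])+
  have q1: "((\<lambda>r. f1 r / (r - R)) \<longlongrightarrow> d1 R) (at_right R)" and q2: "((\<lambda>r. f2 r / (r - R)) \<longlongrightarrow> d1 R) (at_right R)"
    using f1(1)[of R] f2(1)[of R] bdry slope
    by (auto simp: has_field_derivative_iff intro: tendsto_within_subset)
  have c: "(h' \<longlongrightarrow> h' R) (at_right R)" "(d1 \<longlongrightarrow> d1 R) (at_right R)" "(d2 \<longlongrightarrow> d1 R) (at_right R)"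
    "(f1 \<longlongrightarrow> 0) (at_right R)" "(f2 \<longlongrightarrow> 0) (at_right R)"
    using cont bdry slope by (auto simp: isCont_def intro: tendsto_within_subset)
  define V where "V = h' R - \<epsilon> / l1 * d1 R + \<epsilon> / l2 * d1 R"
  have V: "V < 0" using decr[of R 0] slope by (simp add: V_def)
  define g where "g = (\<lambda>r. \<epsilon> * (f1 r / (r - R)) - \<epsilon> * (f2 r / (r - R)))"
  have g: "(g \<longlongrightarrow> \<epsilon> * d1 R - \<epsilon> * d1 R) (at_right R)"
    unfolding g_def by (intro tendsto_intros q1 q2)
  have Ut0: "((\<lambda>r. Ut r 0) \<longlongrightarrow> \<epsilon> * 0 - \<epsilon> * 0) (at_right R)"
  proof -
    have "(\<lambda>r. Ut r 0) = (\<lambda>r. \<epsilon> * f1 r - \<epsilon> * f2 r)" by (simp add: Ut_def)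
    then show ?thesis using tendsto_diff[OF tendsto_mult_left[OF c(4)] tendsto_mult_left[OF c(5)]] by (simp only:)
  qed
  have Ur0: "((\<lambda>r. Ur r 0) \<longlongrightarrow> V) (at_right R)"
    unfolding Ur_def V_def mult_zero_right exp_zero mult_1_right by (intro tendsto_intros c)
  \<comment> \<open>\<open>Q r 0\<close> divided by \<open>r - R\<close>: one factor
    \<open>Ut r 0\<close> becomes \<open>g r\<close>, and the terms with the square of
    \<open>Ur\<close> receive the difference quotients of \<open>f1\<close> and \<open>f2\<close>.
    Equal slopes make \<open>g\<close> tend to 0, so only
    \<open>\<epsilon> * (V\<^sup>2 * d1 R) * (l2 - l1)\<close> survives in the limit.\<close>
  define T where "T = (\<lambda>r. g r * Ut r 0 * (- (m / r) * h' r)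
    - \<epsilon> / l1 * (g r * Ut r 0 * (- (m / r) * d1 r - l1 * f1 r) + 2 * l1 * g r * Ur r 0 * d1 r + l1\<^sup>2 * (Ur r 0)\<^sup>2 * (f1 r / (r - R)))
    + \<epsilon> / l2 * (g r * Ut r 0 * (- (m / r) * d2 r - l2 * f2 r) + 2 * l2 * g r * Ur r 0 * d2 r + l2\<^sup>2 * (Ur r 0)\<^sup>2 * (f2 r / (r - R))))"
  have "(T \<longlongrightarrow> (\<epsilon> * d1 R - \<epsilon> * d1 R) * (\<epsilon> * 0 - \<epsilon> * 0) * (- (m / R) * h' R)
    - \<epsilon> / l1 * ((\<epsilon> * d1 R - \<epsilon> * d1 R) * (\<epsilon> * 0 - \<epsilon> * 0) * (- (m / R) * d1 R - l1 * 0) + 2 * l1 * (\<epsilon> * d1 R - \<epsilon> * d1 R) * V * d1 R + l1\<^sup>2 * V\<^sup>2 * d1 R)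
    + \<epsilon> / l2 * ((\<epsilon> * d1 R - \<epsilon> * d1 R) * (\<epsilon> * 0 - \<epsilon> * 0) * (- (m / R) * d1 R - l2 * 0) + 2 * l2 * (\<epsilon> * d1 R - \<epsilon> * d1 R) * V * d1 R + l2\<^sup>2 * V\<^sup>2 * d1 R)) (at_right R)"
    unfolding T_def using R by (intro tendsto_intros c g Ut0 Ur0 q1 q2) auto
  then have "(T \<longlongrightarrow> \<epsilon> * (V\<^sup>2 * d1 R) * (l2 - l1)) (at_right R)"
    using l by (simp add: algebra_simps power2_eq_square)
  moreover have "0 < \<epsilon> * (V\<^sup>2 * d1 R) * (l2 - l1)" using \<epsilon> V slope l by simp
  ultimately have "eventually (\<lambda>r. 0 < T r) (at_right R)" by (rule order_tendstoD)
  moreover have "eventually (\<lambda>r. r \<in> {R<..<R+1}) (at_right R)" by (intro eventually_at_right_real) simp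
  ultimately have "eventually (\<lambda>r. 0 < T r \<and> r \<in> {R<..<R+1}) (at_right R)" by (rule eventually_conj)
  then obtain r where r: "0 < T r" "r \<in> {R<..<R+1}"
    using eventually_happens[of _ "at_right R"] by auto
  have nz: "r - R \<noteq> 0" using r by auto
  have fr: "(r - R) * (f1 r / (r - R)) = f1 r" "(r - R) * (f2 r / (r - R)) = f2 r" using nz by auto
  have "k * (\<epsilon> * A - \<epsilon> * B) = \<epsilon> * (k * A) - \<epsilon> * (k * B)" for k A B
    by (simp add: algebra_simps)
  then have gr: "(r - R) * g r = Ut r 0" unfolding g_def by (simp only: fr) (simp add: Ut_def)
  have "(r - R) * T r = (r - R) * g r * Ut r 0 * (- (m / r) * h' r)
    - \<epsilon> / l1 * ((r - R) * g r * Ut r 0 * (- (m / r) * d1 r - l1 * f1 r) + 2 * l1 * ((r - R) * g r) * Ur r 0 * d1 r + l1\<^sup>2 * (Ur r 0)\<^sup>2 * ((r - R) * (f1 r / (r - R))))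
    + \<epsilon> / l2 * ((r - R) * g r * Ut r 0 * (- (m / r) * d2 r - l2 * f2 r) + 2 * l2 * ((r - R) * g r) * Ur r 0 * d2 r + l2\<^sup>2 * (Ur r 0)\<^sup>2 * ((r - R) * (f2 r / (r - R))))"
    unfolding T_def by (simp only: ring_distribs mult_ac right_diff_distrib)
  then have "(r - R) * T r = Q r 0"
    unfolding gr fr Q_def by (simp add: power2_eq_square)
  then have "0 < Q r 0" using r by (metis diff_gt_0_iff_gt greaterThanLessThan_iff mult_pos_pos)
  then show ?thesis using r(2) by blast
qed

text \<open>A strictly positive time leaves room for a segment on both sides in time; continuity in
  \<open>t\<close> carries the sign over from time 0.\<close>

lemma Q_pos:
  assumes "0 < T"
  shows "\<exists>r\<in>{R<..<R+1}. \<exists>t\<in>{0<..<T}. 0 < Q r t"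
proof -
  obtain r where r: "r \<in> {R<..<R+1}" "0 < Q r 0" using Q_pos_initial by blast
  have "isCont (\<lambda>t. Q r t) 0"
    unfolding Q_def Ut_def Ur_def by (intro continuous_intros)
  then have "((\<lambda>t. Q r t) \<longlongrightarrow> Q r 0) (at_right 0)"
    unfolding isCont_def by (rule tendsto_within_subset) simp
  then have "eventually (\<lambda>t. 0 < Q r t) (at_right 0)" using r(2) by (rule order_tendstoD)
  then have "eventually (\<lambda>t. 0 < Q r t \<and> t \<in> {0<..<T}) (at_right 0)"
    using eventually_at_right_real[OF assms] by (rule eventually_conj)
  then obtain t where "0 < Q r t" "t \<in> {0<..<T}"
    using eventually_happens[of _ "at_right (0::real)"] by auto
  then show ?thesis using r by blast
qed

text \<open>The segment is tangent to the level curve at its midpoint, where the second derivative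
  \<open>Q\<close> is positive, so both end points have strictly larger values.\<close>

lemma level_curve_convex:
  assumes "0 < T"
  obtains r t \<alpha> \<beta> where "R < r + \<alpha>" "r + \<alpha> < R + 1" "R < r - \<alpha>" "r - \<alpha> < R + 1" "R < r" "r < R + 1"
    "0 \<le> t - \<beta>" "t - \<beta> < T" "0 \<le> t + \<beta>" "t + \<beta> < T"
    "U r t < U (r + \<alpha>) (t + \<beta>)" "U r t < U (r - \<alpha>) (t - \<beta>)"
proof -
  obtain r t where r: "r \<in> {R<..<R+1}" and t: "t \<in> {0<..<T}" and Qp: "0 < Q r t"
    using Q_pos[OF assms] by blast
  define a b where "a = Ut r t" and "b = - Ur r t"
  define M where "M = \<bar>a\<bar> + \<bar>b\<bar> + 1"
  \<comment> \<open>This keeps the whole segment inside the open ring and the open time window; the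
    summand 1 in \<open>M\<close> makes \<open>M\<close> positive and strictly larger than both
    components of the direction.\<close>
  define \<delta> where "\<delta> = Min {r - R, R + 1 - r, t, T - t} / M"
  have M: "\<bar>a\<bar> < M" "\<bar>b\<bar> < M" "0 < M" by (auto simp: M_def)
  have mpos: "0 < Min {r - R, R + 1 - r, t, T - t}" using r t by auto
  then have \<delta>: "0 < \<delta>" using M by (simp add: \<delta>_def)
  have small: "\<bar>s * c\<bar> < r - R" "\<bar>s * c\<bar> < R + 1 - r" "\<bar>s * c\<bar> < t" "\<bar>s * c\<bar> < T - t"
    if "\<bar>s\<bar> < \<delta>" "\<bar>c\<bar> < M" for s c
  proof -
    have "\<bar>s * c\<bar> \<le> \<bar>s\<bar> * M" unfolding abs_mult using that by (intro mult_left_mono) auto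
    also have "\<dots> < \<delta> * M" using that M by (intro mult_strict_right_mono) auto
    also have "\<dots> = Min {r - R, R + 1 - r, t, T - t}" using M by (simp add: \<delta>_def)
    finally show "\<bar>s * c\<bar> < r - R" "\<bar>s * c\<bar> < R + 1 - r" "\<bar>s * c\<bar> < t" "\<bar>s * c\<bar> < T - t" by auto
  qed
  have range: "R - 1/2 < r + s * a" "r + s * a < R + 3/2" if "\<bar>s\<bar> < \<delta>" for s
    using small(1,2)[OF that M(1)] by linarith+
  have r': "R - 1/2 < r" "r < R + 3/2" using r by auto
  define g where "g = (\<lambda>s. U (r + s * a) (t + s * b))"
  \<comment> \<open>The terms with eigenvalue 0 are written out so that the general line derivatives
    apply to \<open>h\<close> literally.\<close>
  define g' where "g' = (\<lambda>s. (a * h' (r + s * a) - 0 * b * h (r + s * a)) * exp (- 0 * (t + s * b))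
    - \<epsilon> / l1 * ((a * d1 (r + s * a) - l1 * b * f1 (r + s * a)) * exp (- l1 * (t + s * b)))
    + \<epsilon> / l2 * ((a * d2 (r + s * a) - l2 * b * f2 (r + s * a)) * exp (- l2 * (t + s * b))))"
  have g_eq: "g = (\<lambda>s. h (r + s * a) * exp (- 0 * (t + s * b)) - \<epsilon> / l1 * (f1 (r + s * a) * exp (- l1 * (t + s * b)))
     + \<epsilon> / l2 * (f2 (r + s * a) * exp (- l2 * (t + s * b))))"
    by (simp add: g_def U_def)
  have "(g has_real_derivative g' s) (at s)" if "\<bar>s\<bar> < \<delta>" for s
    unfolding g_eq g'_def
    by (intro DERIV_add DERIV_diff DERIV_cmult separated_line_derivatives(1)[OF h] separated_line_derivatives(1)[OF f1]
        separated_line_derivatives(1)[OF f2]) (use range[OF that] in auto)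
  moreover have "(g' has_real_derivative Q r t) (at 0)"
  proof -
    have "(g' has_real_derivative
      (a\<^sup>2 * (- (m / r) * h' r - 0 * h r) - 2 * 0 * a * b * h' r + 0\<^sup>2 * b\<^sup>2 * h r) * exp (- 0 * t)
      - \<epsilon> / l1 * ((a\<^sup>2 * (- (m / r) * d1 r - l1 * f1 r) - 2 * l1 * a * b * d1 r + l1\<^sup>2 * b\<^sup>2 * f1 r) * exp (- l1 * t))
      + \<epsilon> / l2 * ((a\<^sup>2 * (- (m / r) * d2 r - l2 * f2 r) - 2 * l2 * a * b * d2 r + l2\<^sup>2 * b\<^sup>2 * f2 r) * exp (- l2 * t))) (at 0)"
      unfolding g'_def
      by (intro DERIV_add DERIV_diff DERIV_cmult separated_line_derivatives(2)[OF h] separated_line_derivatives(2)[OF f1]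
        separated_line_derivatives(2)[OF f2]) (use r' in auto)
    then show ?thesis by (rule DERIV_cong) (simp add: Q_def a_def b_def)
  qed
  moreover have "g' 0 = 0"
  proof -
    have "g' 0 = a * Ur r t + b * Ut r t"
      unfolding g'_def Ur_def Ut_def using l by (simp add: field_simps)
    then show ?thesis by (simp add: a_def b_def)
  qed
  ultimately obtain \<eta> where \<eta>: "0 < \<eta>" "\<And>s. 0 < \<bar>s\<bar> \<Longrightarrow> \<bar>s\<bar> < \<eta> \<Longrightarrow> g 0 < g s"
    using strict_local_min_second_derivative[of \<delta> g g' "Q r t"] \<delta> Qp by blast
  define s where "s = min \<delta> \<eta> / 2"
  have s: "0 < s" "\<bar>s\<bar> < \<delta>" "\<bar>s\<bar> < \<eta>" "\<bar>- s\<bar> < \<eta>" using \<delta> \<eta>(1) by (auto simp: s_def)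
  show ?thesis
  proof (rule that[of r "s * a" t "s * b"])
    show "U r t < U (r + s * a) (t + s * b)" "U r t < U (r - s * a) (t - s * b)"
      using \<eta>(2)[of s] \<eta>(2)[of "- s"] s by (auto simp: g_def)
  qed (use small[OF s(2) M(1)] small[OF s(2) M(2)] r in auto)
qed

end

subsection \<open>The solution on the ring\<close>

lemma Ck_on_subset: "Ck_on k U f \<Longrightarrow> V \<subseteq> U \<Longrightarrow> Ck_on k V f"
  by (induction k arbitrary: f) (auto intro: continuous_on_subset)

lemma ring_domain_ball:
  "ring_domain (ball (0 :: real ^ 'n::finite) (R + 1)) (ball 0 R) = {x. R < norm x \<and> norm x < R + 1}" if "0 < R"
  using that by (auto simp: ring_domain_def)

text \<open>Boundary points are approached radially, by moving the norm towards the middle radius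
  \<open>R + 1/2\<close>.\<close>

lemma closure_annulus:
  assumes "0 < R"
  shows "closure {x :: 'a::real_normed_vector. R < norm x \<and> norm x < R + 1} = {x. R \<le> norm x \<and> norm x \<le> R + 1}"
proof
  have "closed {x :: 'a. R \<le> norm x \<and> norm x \<le> R + 1}"
    by (intro closed_Collect_conj closed_Collect_le continuous_intros)
  then show "closure {x :: 'a. R < norm x \<and> norm x < R + 1} \<subseteq> {x. R \<le> norm x \<and> norm x \<le> R + 1}"
    by (intro closure_minimal) auto
  show "{x :: 'a. R \<le> norm x \<and> norm x \<le> R + 1} \<subseteq> closure {x. R < norm x \<and> norm x < R + 1}"
  proof
    fix x :: 'a assume "x \<in> {x. R \<le> norm x \<and> norm x \<le> R + 1}"
    then have x: "R \<le> norm x" "norm x \<le> R + 1" "norm x \<noteq> 0" using assms by auto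
    define c where "c = R + 1/2"
    define \<rho> where "\<rho> = (\<lambda>k. norm x + (c - norm x) * inverse (real (Suc k)))"
    have "(\<lambda>k. (\<rho> k / norm x) *\<^sub>R x) \<longlonglongrightarrow> ((norm x + (c - norm x) * 0) / norm x) *\<^sub>R x"
      unfolding \<rho>_def using x by (intro tendsto_intros LIMSEQ_inverse_real_of_nat) auto
    then have lim: "(\<lambda>k. (\<rho> k / norm x) *\<^sub>R x) \<longlonglongrightarrow> x" using x by simp
    have "(\<rho> k / norm x) *\<^sub>R x \<in> {x. R < norm x \<and> norm x < R + 1}" for k
    proof -
      define \<theta> where "\<theta> = inverse (real (Suc k))"
      have \<theta>: "0 < \<theta>" "\<theta> \<le> 1" by (auto simp: \<theta>_def inverse_le_1_iff)
      have "\<rho> k = (1 - \<theta>) * norm x + \<theta> * c" by (simp add: \<rho>_def \<theta>_def algebra_simps)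
      moreover have "(1 - \<theta>) * R \<le> (1 - \<theta>) * norm x" "(1 - \<theta>) * norm x \<le> (1 - \<theta>) * (R + 1)"
        using \<theta> x by (auto intro!: mult_left_mono)
      ultimately have "R < \<rho> k" "\<rho> k < R + 1" using \<theta>(1) by (auto simp: c_def algebra_simps)
      then show ?thesis using assms x by simp
    qed
    then show "x \<in> closure {x. R < norm x \<and> norm x < R + 1}"
      unfolding closure_sequential using lim by (intro exI[of _ "\<lambda>k. (\<rho> k / norm x) *\<^sub>R x"] conjI allI)
  qed
qed

context separated_profile
begin

text \<open>Negative times are included, so smoothness at \<open>t = 0\<close> and at the corners
  comes from one open set. The margin 1/2 stays clear of the origin because
  \<open>R > 1\<close>.\<close>

lemma Ck_on_U:
  "Ck_on k {p :: 'a::euclidean_space \<times> real. R - 1/2 < norm (fst p) \<and> norm (fst p) < R + 3/2} (\<lambda>p. U (norm (fst p)) (snd p))"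
proof -
  let ?A = "{p :: 'a \<times> real. R - 1/2 < norm (fst p) \<and> norm (fst p) < R + 3/2}"
  have R0: "0 \<le> R - 1/2" using R by simp
  have "Ck_on k ?A (\<lambda>p. h (norm (fst p)) * exp (- 0 * snd p))"
    by (rule separated_Ck_on[where m = m, OF R0]) (use h in auto)
  moreover have "Ck_on k ?A (\<lambda>p. f1 (norm (fst p)) * exp (- l1 * snd p))"
    by (rule separated_Ck_on[where m = m, OF R0]) (use f1 in auto)
  moreover have "Ck_on k ?A (\<lambda>p. f2 (norm (fst p)) * exp (- l2 * snd p))"
    by (rule separated_Ck_on[where m = m, OF R0]) (use f2 in auto)
  ultimately have "Ck_on k ?A (\<lambda>p. 1 * (1 * (h (norm (fst p)) * exp (- 0 * snd p)) + (- \<epsilon> / l1) * (f1 (norm (fst p)) * exp (- l1 * snd p)))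
      + \<epsilon> / l2 * (f2 (norm (fst p)) * exp (- l2 * snd p)))"
    by (intro Ck_on_linear open_annulus)
  then show ?thesis by (simp add: U_def)
qed

text \<open>The domains are fixed by equations, so that instantiation with \<open>refl\<close>
  yields facts about the literal balls of the theorem. Here \<open>m\<close> is tied to the
  dimension.\<close>

context
  fixes u :: "(real ^ 'n::finite) \<times> real \<Rightarrow> real" and \<Omega>0 \<Omega>1 \<Omega> :: "(real ^ 'n) set"
  assumes u_def: "u = (\<lambda>p. U (norm (fst p)) (snd p))" and dim: "m = real CARD('n) - 1"
    and \<Omega>0_def: "\<Omega>0 = ball 0 (R + 1)" and \<Omega>1_def: "\<Omega>1 = ball 0 R" and \<Omega>_def: "\<Omega> = ring_domain \<Omega>0 \<Omega>1"
begin

lemma \<Omega>_eq: "\<Omega> = {x. R < norm x \<and> norm x < R + 1}"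
  unfolding \<Omega>_def \<Omega>0_def \<Omega>1_def using R by (intro ring_domain_ball) simp

lemma closure_\<Omega>: "closure \<Omega> = {x. R \<le> norm x \<and> norm x \<le> R + 1}"
  unfolding \<Omega>_eq using R by (intro closure_annulus) simp

lemma frontiers: "frontier \<Omega>0 = {x. norm x = R + 1}" "frontier \<Omega>1 = {x. norm x = R}"
  using R by (auto simp: \<Omega>0_def \<Omega>1_def)

lemma laplacian_u: "laplacian (\<lambda>y. u (y, t)) x = Ut (norm x) t" if "x \<in> \<Omega>"
proof -
  have x: "R - 1/2 < norm x" "norm x < R + 3/2" using that by (auto simp: \<Omega>_eq)
  have R0: "0 \<le> R - 1/2" using R by simp
  have "laplacian (\<lambda>y. U (norm y) t) x = (Ut (norm x) t - m / norm x * Ur (norm x) t) + (real CARD('n) - 1) / norm x * Ur (norm x) t"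
    by (rule laplacian_radial[OF R0 x, where F = "\<lambda>r. U r t"]) (use U_deriv_r Ur_deriv_r x in auto)
  then show ?thesis by (simp add: u_def dim)
qed

lemma gradient_u: "x \<bullet> gradient (\<lambda>y. u (y, t)) x = norm x * Ur (norm x) t" if "x \<in> \<Omega>"
proof -
  have x: "R - 1/2 < norm x" "norm x < R + 3/2" using that by (auto simp: \<Omega>_eq)
  have R0: "0 \<le> R - 1/2" using R by simp
  have "x \<bullet> gradient (\<lambda>y. U (norm y) t) x = norm x * Ur (norm x) t"
    by (rule gradient_radial[OF R0 x, where F = "\<lambda>r. U r t"]) (use U_deriv_r in auto)
  then show ?thesis by (simp add: u_def)
qed

lemma smooth_u: "smooth_on (closure \<Omega> \<times> {0..}) u"
  unfolding smooth_on_def u_def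
  by (rule exI[of _ "{p. R - 1/2 < norm (fst p) \<and> norm (fst p) < R + 3/2}"],
      rule exI[of _ "\<lambda>p. U (norm (fst p)) (snd p)"])
     (auto simp: closure_\<Omega> intro: open_annulus Ck_on_U)

lemma smooth_u0: "smooth_on (closure \<Omega>) (\<lambda>x. u (x, 0))"
proof -
  let ?A = "{p :: (real ^ 'n) \<times> real. R - 1/2 < norm (fst p) \<and> norm (fst p) < R + 3/2}"
  have "Ck_on k {x. (x, 0) \<in> ?A} (\<lambda>x. u (x, 0))" for k
    unfolding u_def by (rule Ck_on_slice[OF open_annulus Ck_on_U])
  moreover have "open {x. (x, 0) \<in> ?A}" by (rule open_slice[OF open_annulus])
  moreover have "closure \<Omega> \<subseteq> {x. (x, 0) \<in> ?A}" by (auto simp: closure_\<Omega>)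
  ultimately show ?thesis unfolding smooth_on_def by blast
qed

lemma admissible_u0: "admissible \<Omega>0 \<Omega>1 (\<lambda>x. u (x, 0))"
  unfolding admissible_def \<Omega>_def[symmetric]
proof (intro conjI ballI smooth_u0)
  fix x assume x: "x \<in> \<Omega>"
  then have r: "norm x \<in> {R..R+1}" by (auto simp: \<Omega>_eq)
  show "x \<bullet> gradient (\<lambda>x. u (x, 0)) x \<le> 0"
    unfolding gradient_u[OF x] using Ur_neg[OF r, of 0] by (simp add: mult_nonneg_nonpos)
  show "0 \<le> laplacian (\<lambda>x. u (x, 0)) x"
    unfolding laplacian_u[OF x] using le[OF r] \<epsilon> by (simp add: Ut_def)
next
  obtain r where r: "r \<in> {R<..<R+1}" "f2 r < f1 r" using lt by blast
  define x where "x = r *\<^sub>R (axis undefined 1 :: real ^ 'n)"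
  have n: "norm x = r" using r R by (simp add: x_def)
  show "\<exists>x\<in>\<Omega>. laplacian (\<lambda>x. u (x, 0)) x \<noteq> 0"
  proof
    show x: "x \<in> \<Omega>" using n r by (simp add: \<Omega>_eq)
    show "laplacian (\<lambda>x. u (x, 0)) x \<noteq> 0"
      unfolding laplacian_u[OF x] n using r \<epsilon> by (simp add: Ut_def)
  qed
qed (use U_bdry in \<open>auto simp: frontiers u_def\<close>)

lemma heat_solution_u: "heat_solution \<Omega>0 \<Omega>1 (\<lambda>x. u (x, 0)) u"
  unfolding heat_solution_def \<Omega>_def[symmetric]
proof (intro conjI ballI allI impI)
  let ?A = "{p :: (real ^ 'n) \<times> real. R - 1/2 < norm (fst p) \<and> norm (fst p) < R + 3/2}"
  have "continuous_on ?A u" unfolding u_def using Ck_on_U[of 0] by simp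
  then show "continuous_on (closure \<Omega> \<times> {0..}) u"
    by (rule continuous_on_subset) (auto simp: closure_\<Omega>)
  have "open \<Omega>" unfolding \<Omega>_eq by (intro open_Collect_conj open_Collect_less continuous_intros)
  moreover have "\<Omega> \<times> UNIV \<subseteq> ?A" by (auto simp: \<Omega>_eq)
  then have "Ck_on k (\<Omega> \<times> UNIV) u" for k
    unfolding u_def by (rule Ck_on_subset[OF Ck_on_U])
  ultimately show "C21_on \<Omega> u" by (rule C21_on_if_Ck_on)
  show "deriv (\<lambda>s. u (x, s)) t = laplacian (\<lambda>y. u (y, t)) x" if "x \<in> \<Omega>" for x t
    unfolding laplacian_u[OF that] using U_deriv_t by (intro DERIV_imp_deriv) (simp add: u_def)
qed (use U_bdry in \<open>auto simp: frontiers u_def\<close>)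

text \<open>Comparison in both directions. The boundary of the ring consists of the two spheres,
  where values are prescribed for all \<open>t \<ge> 0\<close>, corners included.\<close>

lemma heat_solution_unique:
  assumes v: "heat_solution \<Omega>0 \<Omega>1 (\<lambda>x. u (x, 0)) v" and x: "x \<in> closure \<Omega>" and t: "0 \<le> t"
  shows "v (x, t) = u (x, t)"
proof -
  have \<Omega>: "open \<Omega>" "bounded \<Omega>"
  proof -
    show "open \<Omega>" unfolding \<Omega>_eq by (intro open_Collect_conj open_Collect_less continuous_intros)
    show "bounded \<Omega>" unfolding bounded_iff \<Omega>_eq by (intro exI[of _ "R + 1"]) auto
  qed
  have bd: "x \<in> frontier \<Omega>0 \<or> x \<in> frontier \<Omega>1" if "x \<in> closure \<Omega> - \<Omega>" for x
  proof -
    have "R \<le> norm x" "norm x \<le> R + 1" using that by (auto simp: closure_\<Omega>)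
    moreover have "\<not> (R < norm x \<and> norm x < R + 1)" using that by (auto simp: \<Omega>_eq)
    ultimately show ?thesis unfolding frontiers by force
  qed
  have comp: "w (x, t) \<le> w' (x, t)"
    if w: "heat_solution \<Omega>0 \<Omega>1 (\<lambda>x. u (x, 0)) w" and w': "heat_solution \<Omega>0 \<Omega>1 (\<lambda>x. u (x, 0)) w'" for w w'
  proof (rule heat_comparison[OF \<Omega> _ _ _ _ _ _ _ _ x t])
    note W = w[unfolded heat_solution_def \<Omega>_def[symmetric]] and W' = w'[unfolded heat_solution_def \<Omega>_def[symmetric]]
    show "continuous_on (closure \<Omega> \<times> {0..}) w'" "continuous_on (closure \<Omega> \<times> {0..}) w"
      "C21_on \<Omega> w'" "C21_on \<Omega> w"
      using W W' by blast+
    show "deriv (\<lambda>s. w' (y, s)) s = laplacian (\<lambda>z. w' (z, s)) y" if "y \<in> \<Omega>" "0 < s" for y s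
      using W' that by blast
    show "deriv (\<lambda>s. w (y, s)) s = laplacian (\<lambda>z. w (z, s)) y" if "y \<in> \<Omega>" "0 < s" for y s
      using W that by blast
    show "w (y, 0) \<le> w' (y, 0)" if "y \<in> \<Omega>" for y
    proof -
      have "w (y, 0) = u (y, 0)" "w' (y, 0) = u (y, 0)" using W W' that by blast+
      then show ?thesis by simp
    qed
    show "w (y, s) \<le> w' (y, s)" if "y \<in> closure \<Omega> - \<Omega>" "0 \<le> s" for y s
      using bd[OF that(1)]
    proof
      assume "y \<in> frontier \<Omega>0"
      then have "w (y, s) = 0" "w' (y, s) = 0" using W W' that(2) by blast+
      then show ?thesis by simp
    next
      assume "y \<in> frontier \<Omega>1"
      then have "w (y, s) = 1" "w' (y, s) = 1" using W W' that(2) by blast+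
      then show ?thesis by simp
    qed
  qed
  show ?thesis using comp[OF v heat_solution_u] comp[OF heat_solution_u v] by simp
qed

section \<open>Convexity of the superlevel sets in space and its failure in space-time\<close>

lemma quasiconcave_u:
  assumes "0 \<le> t"
  shows "quasiconcave \<Omega>0 \<Omega>1 (\<lambda>x. u (x, t))"
  unfolding quasiconcave_def \<Omega>_def[symmetric]
proof
  fix c
  let ?S = "{x \<in> closure \<Omega>. c \<le> u (x, t)} \<union> \<Omega>1"
  \<comment> \<open>Since \<open>U\<close> is radially nonincreasing, a superlevel set together with
    the inner ball is closed under decreasing the norm; a convex combination never exceeds the
    larger norm.\<close>
  have down: "y \<in> ?S" if "x \<in> ?S" "norm y \<le> norm x" for x y
  proof (cases "norm y < R")
    case False
    then have "R \<le> norm y" "norm x \<le> R + 1" "c \<le> U (norm x) t"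
      using that by (auto simp: \<Omega>1_def closure_\<Omega> u_def)
    then show ?thesis
      using U_antimono[of "norm y" "norm x" t] that(2) assms by (auto simp: closure_\<Omega> u_def)
  qed (simp add: \<Omega>1_def)
  show "convex ?S"
  proof (rule convexI)
    fix x y and a b :: real assume xy: "x \<in> ?S" "y \<in> ?S" and ab: "0 \<le> a" "0 \<le> b" "a + b = 1"
    define M where "M = max (norm x) (norm y)"
    have "norm (a *\<^sub>R x + b *\<^sub>R y) \<le> a * norm x + b * norm y"
      using norm_triangle_ineq[of "a *\<^sub>R x" "b *\<^sub>R y"] ab by simp
    also have "\<dots> \<le> a * M + b * M"
      using ab by (intro add_mono mult_left_mono) (auto simp: M_def)
    also have "\<dots> = M" using ab(3) by (metis distrib_right mult_1)
    finally have "norm (a *\<^sub>R x + b *\<^sub>R y) \<le> norm x \<or> norm (a *\<^sub>R x + b *\<^sub>R y) \<le> norm y"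
      by (simp add: M_def le_max_iff_disj)
    then show "a *\<^sub>R x + b *\<^sub>R y \<in> ?S"
      using down[OF xy(1)] down[OF xy(2)] by blast
  qed
qed

lemma not_spacetime_quasiconcave_u:
  assumes "0 < T"
  shows "\<not> spacetime_quasiconcave \<Omega>0 \<Omega>1 T u"
proof
  assume *: "spacetime_quasiconcave \<Omega>0 \<Omega>1 T u"
  \<comment> \<open>\<open>T\<close> may be infinite; \<open>T'\<close> provides a real time window
    below it.\<close>
  obtain T' where "0 < ereal T'" "ereal T' < T" using ereal_dense2[OF assms] by blast
  then have T': "0 < T'" "ereal T' < T" by simp_all
  obtain r t \<alpha> \<beta> where r: "R < r + \<alpha>" "r + \<alpha> < R + 1" "R < r - \<alpha>" "r - \<alpha> < R + 1" "R < r" "r < R + 1"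
    and t: "0 \<le> t - \<beta>" "t - \<beta> < T'" "0 \<le> t + \<beta>" "t + \<beta> < T'"
    and U: "U r t < U (r + \<alpha>) (t + \<beta>)" "U r t < U (r - \<alpha>) (t - \<beta>)"
    by (rule level_curve_convex[OF T'(1)])
  \<comment> \<open>Both end points reach this level while the midpoint falls below it, and
    \<open>R < r\<close> keeps the midpoint out of the inner ball.\<close>
  define c where "c = min (U (r + \<alpha>) (t + \<beta>)) (U (r - \<alpha>) (t - \<beta>))"
  define e where "e = (axis undefined 1 :: real ^ 'n)"
  have ne: "norm (s *\<^sub>R e) = s" if "R < s" for s using that R by (simp add: e_def)
  let ?S = "{p \<in> closure \<Omega> \<times> time_interval T. c \<le> u p} \<union> \<Omega>1 \<times> time_interval T"
  have conv: "convex ?S" using * unfolding spacetime_quasiconcave_def \<Omega>_def[symmetric] by blast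
  have time: "s \<in> time_interval T" if "0 \<le> s" "s < T'" for s
  proof -
    have "ereal s < ereal T'" using that by simp
    then have "ereal s < T" using T'(2) by (rule less_trans)
    then show ?thesis using that by (simp add: time_interval_def)
  qed
  have "((r + \<alpha>) *\<^sub>R e, t + \<beta>) \<in> ?S"
    using ne[OF r(1)] r time[OF t(3,4)] by (auto simp: closure_\<Omega> u_def c_def)
  moreover have "((r - \<alpha>) *\<^sub>R e, t - \<beta>) \<in> ?S"
    using ne[OF r(3)] r time[OF t(1,2)] by (auto simp: closure_\<Omega> u_def c_def)
  ultimately have "(1/2) *\<^sub>R ((r + \<alpha>) *\<^sub>R e, t + \<beta>) + (1/2) *\<^sub>R ((r - \<alpha>) *\<^sub>R e, t - \<beta>) \<in> ?S"
    by (intro convexD[OF conv]) auto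
  moreover have "(1/2) *\<^sub>R ((r + \<alpha>) *\<^sub>R e, t + \<beta>) + (1/2) *\<^sub>R ((r - \<alpha>) *\<^sub>R e, t - \<beta>) = (r *\<^sub>R e, t)"
  proof -
    have "1/2 * (r + \<alpha>) + 1/2 * (r - \<alpha>) = r" "1/2 * (t + \<beta>) + 1/2 * (t - \<beta>) = t"
      by (simp_all add: field_simps)
    then show ?thesis
      by (simp only: scaleR_Pair add_Pair scaleR_scaleR scaleR_add_left[symmetric] real_scaleR_def)
  qed
  ultimately have "(r *\<^sub>R e, t) \<in> ?S" by simp
  then show False using ne[OF r(5)] r(5) U by (auto simp: \<Omega>1_def u_def c_def)
qed

end

end

section \<open>Choice of the amplitude for a given radius\<close>

theorem theorem1p2:
  "\<exists>R0. \<forall>R::real. R > 1 \<and> R \<ge> R0 \<longrightarrow>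
     (let \<Omega>1 = ball (0 :: real ^ 'n::finite) R;
          \<Omega>0 = ball (0 :: real ^ 'n) (R + 1);
          \<Omega> = ring_domain \<Omega>0 \<Omega>1
      in \<exists>u0. admissible \<Omega>0 \<Omega>1 u0 \<and>
          (\<exists>u. heat_solution \<Omega>0 \<Omega>1 u0 u \<and>
               (\<forall>v. heat_solution \<Omega>0 \<Omega>1 u0 v \<longrightarrow> (\<forall>p \<in> closure \<Omega> \<times> {0..}. v p = u p)) \<and>
               (radially_symmetric_on (closure \<Omega>) u0 \<and>
                (\<forall>t\<ge>0. quasiconcave \<Omega>0 \<Omega>1 (\<lambda>x. u (x, t)))) \<and>
               smooth_on (closure \<Omega> \<times> {0..}) u \<and>
               (\<forall>T>0. \<not> spacetime_quasiconcave \<Omega>0 \<Omega>1 T u)))"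
proof -
  define m where "m = real CARD('n) - 1"
  obtain R0 where R0: "\<And>R. 1 < R \<and> R0 \<le> R \<Longrightarrow> \<exists>l1 l2 f1 d1 f2 d2. 0 < l1 \<and> l1 < l2 \<and>
    (\<forall>r. R - 1/2 < r \<and> r < R + 3/2 \<longrightarrow>
      (f1 has_real_derivative d1 r) (at r) \<and> (d1 has_real_derivative - (m / r) * d1 r - l1 * f1 r) (at r) \<and>
      (f2 has_real_derivative d2 r) (at r) \<and> (d2 has_real_derivative - (m / r) * d2 r - l2 * f2 r) (at r)) \<and>
    f1 R = 0 \<and> f2 R = 0 \<and> f1 (R + 1) = 0 \<and> f2 (R + 1) = 0 \<and> 0 < d1 R \<and> d2 R = d1 R \<and>
    (\<forall>r\<in>{R..R+1}. f2 r \<le> f1 r) \<and> (\<exists>r\<in>{R<..<R+1}. f2 r < f1 r)"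
    using radial_eigenfunctions[of m] by metis
  show ?thesis
  proof (rule exI[of _ R0], intro allI impI)
    fix R :: real assume R: "R > 1 \<and> R \<ge> R0"
    obtain l1 l2 f1 d1 f2 d2 where l: "0 < l1" "l1 < l2"
      and ode: "\<forall>r. R - 1/2 < r \<and> r < R + 3/2 \<longrightarrow>
        (f1 has_real_derivative d1 r) (at r) \<and> (d1 has_real_derivative - (m / r) * d1 r - l1 * f1 r) (at r) \<and>
        (f2 has_real_derivative d2 r) (at r) \<and> (d2 has_real_derivative - (m / r) * d2 r - l2 * f2 r) (at r)"
      and bdry: "f1 R = 0" "f2 R = 0" "f1 (R + 1) = 0" "f2 (R + 1) = 0" "0 < d1 R" "d2 R = d1 R"
      and ord: "\<forall>r\<in>{R..R+1}. f2 r \<le> f1 r" "\<exists>r\<in>{R<..<R+1}. f2 r < f1 r"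
      using R0[OF R] by blast
    have "0 < R" using R by simp
    then obtain h h' where h: "\<And>r. 0 < r \<Longrightarrow> (h has_real_derivative h' r) (at r)"
      "\<And>r. 0 < r \<Longrightarrow> (h' has_real_derivative - (m / r) * h' r - 0 * h r) (at r)"
      "h R = 1" "h (R + 1) = 0" "\<And>r. 0 < r \<Longrightarrow> h' r < 0"
      using radial_harmonic[of R m] by metis
    let ?I = "{R..R+1}"
    have isC: "isCont h' r" "isCont d1 r" "isCont d2 r" if "r \<in> ?I" for r
    proof -
      have "0 < r" "R - 1/2 < r \<and> r < R + 3/2" using that R by auto
      then show "isCont h' r" "isCont d1 r" "isCont d2 r"
        using h(2) ode DERIV_isCont by blast+
    qed
    have "\<exists>\<kappa>\<in>?I. \<forall>r\<in>?I. h' r \<le> h' \<kappa>"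
      using isC(1) by (intro continuous_attains_sup continuous_at_imp_continuous_on) auto
    then obtain \<kappa> where \<kappa>: "0 < \<kappa>" "\<And>r. r \<in> ?I \<Longrightarrow> h' r \<le> - \<kappa>"
      using h(5) R by (metis (no_types, opaque_lifting) \<open>0 < R\<close> atLeastAtMost_iff minus_minus neg_0_less_iff_less order_less_le_trans)
    have "bounded (d1 ` ?I)" "bounded (d2 ` ?I)"
      using isC(2,3) by (intro compact_imp_bounded compact_continuous_image continuous_at_imp_continuous_on; auto)+
    then obtain B1 B2 where B: "\<And>r. r \<in> ?I \<Longrightarrow> \<bar>d1 r\<bar> \<le> B1" "\<And>r. r \<in> ?I \<Longrightarrow> \<bar>d2 r\<bar> \<le> B2"
      unfolding bounded_iff by (auto simp del: atLeastAtMost_iff)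
    have B0: "0 \<le> B1" "0 \<le> B2" using B[of R] by force+
    \<comment> \<open>For all \<open>t \<ge> 0\<close> the exponentials are at most 1, so the
      perturbation changes the radial slope by at most \<open>\<epsilon> * K\<close>. The divisor
      \<open>K + 1\<close> in \<open>\<epsilon>\<close> keeps this below \<open>\<kappa>\<close>,
      the least steepness of the harmonic profile, also when \<open>K = 0\<close>.\<close>
    define K where "K = B1 / l1 + B2 / l2"
    have K: "0 \<le> K" using B0 l by (simp add: K_def)
    define \<epsilon> where "\<epsilon> = \<kappa> / (K + 1)"
    have \<epsilon>: "0 < \<epsilon>" using \<kappa>(1) K by (simp add: \<epsilon>_def)
    have "\<epsilon> * K < \<kappa>" using \<kappa>(1) K by (simp add: \<epsilon>_def field_simps)
    interpret separated_profile R m \<epsilon> l1 l2 h h' f1 d1 f2 d2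
    proof
      fix r t :: real assume r: "r \<in> ?I" and t: "0 \<le> t"
      have e: "\<bar>\<epsilon> / l * (d * exp (- l * t))\<bar> \<le> \<epsilon> / l * B" if "\<bar>d\<bar> \<le> B" "0 < l" for d l B
      proof -
        have "\<bar>d\<bar> * exp (- l * t) \<le> B * 1" using that t by (intro mult_mono) auto
        then have "\<epsilon> / l * (\<bar>d\<bar> * exp (- l * t)) \<le> \<epsilon> / l * B"
          using \<epsilon> that(2) by (intro mult_left_mono) auto
        then show ?thesis using \<epsilon> that(2) by (simp add: abs_mult)
      qed
      have "0 < l2" using l by simp
      note e[OF B(1)[OF r] l(1)] e[OF B(2)[OF r] this]
      moreover have "\<epsilon> / l1 * B1 + \<epsilon> / l2 * B2 = \<epsilon> * K" by (simp add: K_def algebra_simps)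
      ultimately show "h' r - \<epsilon> / l1 * (d1 r * exp (- l1 * t)) + \<epsilon> / l2 * (d2 r * exp (- l2 * t)) < 0"
        using \<kappa>(2)[OF r] \<open>\<epsilon> * K < \<kappa>\<close> by linarith
    qed (use R l \<epsilon> h ode bdry ord in auto)
    define u where "u = (\<lambda>p :: (real ^ 'n) \<times> real. U (norm (fst p)) (snd p))"
    note facts = u_def m_def refl refl refl
    show "let \<Omega>1 = ball (0 :: real ^ 'n) R; \<Omega>0 = ball (0 :: real ^ 'n) (R + 1); \<Omega> = ring_domain \<Omega>0 \<Omega>1
      in \<exists>u0. admissible \<Omega>0 \<Omega>1 u0 \<and>
          (\<exists>u. heat_solution \<Omega>0 \<Omega>1 u0 u \<and>
               (\<forall>v. heat_solution \<Omega>0 \<Omega>1 u0 v \<longrightarrow> (\<forall>p \<in> closure \<Omega> \<times> {0..}. v p = u p)) \<and>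
               (radially_symmetric_on (closure \<Omega>) u0 \<and>
                (\<forall>t\<ge>0. quasiconcave \<Omega>0 \<Omega>1 (\<lambda>x. u (x, t)))) \<and>
               smooth_on (closure \<Omega> \<times> {0..}) u \<and>
               (\<forall>T>0. \<not> spacetime_quasiconcave \<Omega>0 \<Omega>1 T u))"
      unfolding Let_def
    proof (rule exI[of _ "\<lambda>x. u (x, 0)"], rule conjI[OF admissible_u0[OF facts]], rule exI[of _ u],
        intro conjI allI impI ballI)
      show "heat_solution (ball 0 (R + 1)) (ball 0 R) (\<lambda>x. u (x, 0)) u"
        by (rule heat_solution_u[OF facts])
      show "v p = u p" if "heat_solution (ball 0 (R + 1)) (ball 0 R) (\<lambda>x. u (x, 0)) v"
        "p \<in> closure (ring_domain (ball 0 (R + 1)) (ball 0 R)) \<times> {0..}" for v p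
        using heat_solution_unique[OF facts that(1), of "fst p" "snd p"] that(2) by auto
      show "radially_symmetric_on (closure (ring_domain (ball 0 (R + 1)) (ball 0 R))) (\<lambda>x. u (x, 0))"
        by (simp add: radially_symmetric_on_def u_def)
      show "quasiconcave (ball 0 (R + 1)) (ball 0 R) (\<lambda>x. u (x, t))" if "0 \<le> t" for t
        by (rule quasiconcave_u[OF facts that])
      show "smooth_on (closure (ring_domain (ball 0 (R + 1)) (ball 0 R)) \<times> {0..}) u"
        by (rule smooth_u[OF facts])
      show "\<not> spacetime_quasiconcave (ball 0 (R + 1)) (ball 0 R) T u" if "0 < T" for T
        by (rule not_spacetime_quasiconcave_u[OF facts that])
    qed
  qed
qed

end
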